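(* Let $R=(r_{ij})$ be a real symmetric $n\times n$ matrix with zero diagonal and $\rho(|R|)<1$, with graph $G$, GaBP messages $\alpha$, and belief-propagation estimate $Z^{\mathrm{bp}}$ (defined in the context). For each directed edge $(ij)$ of $G$ set $r'_{ij}=\frac{r_{ij}}{1-\alpha_{i\setminus j}}$. Then $$\det(I-R)^{-1}=Z^{\mathrm{bp}}\times\prod_{\gamma}\Big(1-\prod_{(ij)}(r'_{ij})^{n_{ij}(\gamma)}\Big)^{-1},$$ where the outer product is over all (nonempty) backtrackless orbits $\gamma$ of $G$.
   Context: $|R|=(|r_{ij}|)$ is the entrywise absolute value and $\rho$ the spectral radius. $G$ is the graph on $V=\{1,\dots,n\}$ with undirected edge $\{i,j\}$ whenever $r_{ij}\neq0$; $\partial i$ is the set of neighbours of $i$; each edge gives directed edges $(ij),(ji)$. A walk is a sequence of vertices $(w_0,\dots,w_L)$ with $\{w_t,w_{t+1}\}\in G$; steps are $(w_tw_{t+1})$; closed means $L\ge1$, $w_0=w_L$; a closed walk is primitive if it is not an $m$-fold concatenation ($m\ge2$) of a shorter closed walk. An orbit is an equivalence class of closed primitive walks under cyclic shifts; $n_{ij}(\gamma)$ is the number of occurrences of step $(ij)$ in orbit $\gamma$. An orbit is regarded as a cyclic sequence of steps; a backtracking pair is a pair of cyclically consecutive steps $(ij)(ji)$; an orbit is backtrackless if it has no backtracking pair. GaBP messages: $\alpha_{ij}=\lim_t\alpha^{(t)}_{ij}$ with $\alpha^{(0)}_{ij}=0$, $\alpha^{(t+1)}_{ij}=r_{ij}^2(1-\sum_{k\in\partial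 i\setminus j}\alpha^{(t)}_{ki})^{-1}$ (convergent when $\rho(|R|)<1$, with $1-\alpha_{i\setminus j}>0$). $\alpha_{i\setminus j}=\sum_{k\in\partial i\setminus j}\alpha_{ki}$. $Z_i^{\mathrm{bp}}=(1-\sum_{k\in\partial i}\alpha_{ki})^{-1}$, $Z_{ij}^{\mathrm{bp}}=\det\begin{pmatrix}1-\alpha_{i\setminus j} & -r_{ij}\\ -r_{ij} & 1-\alpha_{j\setminus i}\end{pmatrix}^{-1}$, $Z^{\mathrm{bp}}=\prod_{i\in V}Z_i^{\mathrm{bp}}\prod_{\{i,j\}\in G}\frac{Z_{ij}^{\mathrm{bp}}}{Z_i^{\mathrm{bp}}Z_j^{\mathrm{bp}}}$. *)

theory Defs
  imports "Jordan_Normal_Form.Spectral_Radius"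
begin

definition nbrs :: "real mat \<Rightarrow> nat \<Rightarrow> nat set" where
  "nbrs R i = {k. k < dim_row R \<and> R $$ (i, k) \<noteq> 0}"

fun alpha_iter :: "real mat \<Rightarrow> nat \<Rightarrow> nat \<Rightarrow> nat \<Rightarrow> real" where
  "alpha_iter R 0 i j = 0"
| "alpha_iter R (Suc t) i j =
     (R $$ (i, j))\<^sup>2 * inverse (1 - (\<Sum>k\<in>nbrs R i - {j}. alpha_iter R t k i))"

definition alpha :: "real mat \<Rightarrow> nat \<Rightarrow> nat \<Rightarrow> real" where
  "alpha R i j = lim (\<lambda>t. alpha_iter R t i j)"

definition alpha_excl :: "real mat \<Rightarrow> nat \<Rightarrow> nat \<Rightarrow> real" where
  "alpha_excl R i j = (\<Sum>k\<in>nbrs R i - {j}. alpha R k i)"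

definition Z_node :: "real mat \<Rightarrow> nat \<Rightarrow> real" where
  "Z_node R i = inverse (1 - (\<Sum>k\<in>nbrs R i. alpha R k i))"

definition Z_edge :: "real mat \<Rightarrow> nat \<Rightarrow> nat \<Rightarrow> real" where
  "Z_edge R i j = inverse (det (mat_of_rows_list 2
      [[1 - alpha_excl R i j, - R $$ (i, j)],
       [- R $$ (i, j), 1 - alpha_excl R j i]]))"

definition undir_edges :: "real mat \<Rightarrow> (nat \<times> nat) set" where
  "undir_edges R = {(i, j). i < j \<and> j < dim_row R \<and> R $$ (i, j) \<noteq> 0}"

definition dir_edges :: "real mat \<Rightarrow> (nat \<times> nat) set" where
  "dir_edges R = {(i, j). i < dim_row R \<and> j < dim_row R \<and> R $$ (i, j) \<noteq> 0}"

definition Z_bp :: "real mat \<Rightarrow> real" where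
  "Z_bp R = (\<Prod>i<dim_row R. Z_node R i) *
     (\<Prod>(i, j)\<in>undir_edges R. Z_edge R i j / (Z_node R i * Z_node R j))"

definition r_prime :: "real mat \<Rightarrow> nat \<Rightarrow> nat \<Rightarrow> real" where
  "r_prime R i j = R $$ (i, j) / (1 - alpha_excl R i j)"

definition is_walk :: "real mat \<Rightarrow> nat list \<Rightarrow> bool" where
  "is_walk R ws \<longleftrightarrow> ws \<noteq> [] \<and> set ws \<subseteq> {..<dim_row R} \<and>
     (\<forall>t < length ws - 1. R $$ (ws ! t, ws ! (t + 1)) \<noteq> 0)"

definition steps :: "nat list \<Rightarrow> (nat \<times> nat) list" where
  "steps ws = zip ws (tl ws)"

definition is_closed_walk :: "real mat \<Rightarrow> nat list \<Rightarrow> bool" where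
  "is_closed_walk R ws \<longleftrightarrow> is_walk R ws \<and> length ws \<ge> 2 \<and> hd ws = last ws"

definition walk_pow :: "nat list \<Rightarrow> nat \<Rightarrow> nat list" where
  "walk_pow c m = hd c # concat (replicate m (tl c))"

definition is_primitive :: "real mat \<Rightarrow> nat list \<Rightarrow> bool" where
  "is_primitive R ws \<longleftrightarrow> is_closed_walk R ws \<and>
     \<not> (\<exists>c m. m \<ge> 2 \<and> is_closed_walk R c \<and> length c < length ws \<and> ws = walk_pow c m)"

text \<open>Cyclic shifts of a closed walk correspond to rotations of its step sequence.\<close>
definition cyc_equiv :: "nat list \<Rightarrow> nat list \<Rightarrow> bool" where
  "cyc_equiv ws ws' \<longleftrightarrow> (\<exists>k. steps ws' = rotate k (steps ws))"

definition orbits :: "real mat \<Rightarrow> nat list set set" where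
  "orbits R = {{ws'. is_primitive R ws' \<and> cyc_equiv ws ws'} | ws. is_primitive R ws}"

definition orbit_steps :: "nat list set \<Rightarrow> (nat \<times> nat) list" where
  "orbit_steps \<gamma> = steps (SOME ws. ws \<in> \<gamma>)"

definition n_step :: "nat list set \<Rightarrow> nat \<Rightarrow> nat \<Rightarrow> nat" where
  "n_step \<gamma> i j = count_list (orbit_steps \<gamma>) (i, j)"

definition backtrackless :: "nat list set \<Rightarrow> bool" where
  "backtrackless \<gamma> \<longleftrightarrow> (let s = orbit_steps \<gamma>; L = length s in
     \<forall>t < L. s ! ((t + 1) mod L) \<noteq> (snd (s ! t), fst (s ! t)))"

definition backtrackless_orbits :: "real mat \<Rightarrow> nat list set set" where
  "backtrackless_orbits R = {\<gamma> \<in> orbits R. backtrackless \<gamma>}"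

definition orbit_weight :: "real mat \<Rightarrow> nat list set \<Rightarrow> real" where
  "orbit_weight R \<gamma> = (\<Prod>(i, j)\<in>dir_edges R. (r_prime R i j) ^ n_step \<gamma> i j)"

end

theory Submission
  imports "HOL-Analysis.Complex_Transcendental" "HOL-Analysis.Infinite_Sum" Defs
begin

text \<open>
  Let \<open>M\<close> be the non-backtracking matrix on directed edges with weights \<open>u\<^sub>e = r'\<^sub>e\<close>, that is
  \<open>M\<^sub>e\<^sub>f = u\<^sub>f\<close> if \<open>f\<close> starts where \<open>e\<close> ends and is not the reversal of \<open>e\<close>. Since every cyclic word
  is uniquely a power of a primitive word, \<open>\<Sum>\<^sub>k tr M\<^sup>k / k\<close> equals
  \<open>- \<Sum>\<^sub>\<gamma> ln (1 - u\<^sup>\<gamma>)\<close> over the backtrackless orbits, so the orbit product is \<open>1 / det (I - M)\<close>.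
  A Bass-type determinant formula reduces \<open>det (I - M)\<close> to an \<open>n \<times> n\<close> determinant, which by
  the fixed-point equations of the messages is \<open>Z\<^sub>b\<^sub>p det (I - R)\<close>.

  All estimates come from the vector \<open>x = \<Sum>\<^sub>k |R|\<^sup>k 1\<close>, which satisfies \<open>|R| x = x - 1\<close>: it gives
  \<open>\<alpha>\<^sub>i\<^sub>j \<le> |r\<^sub>i\<^sub>j| x\<^sub>i / x\<^sub>j\<close>, hence convergence of the messages, and
  \<open>v\<^sub>i\<^sub>j = |r\<^sub>i\<^sub>j| (x\<^sub>i - |u\<^sub>i\<^sub>j| x\<^sub>j) > 0\<close> satisfies \<open>v |M| = v - |u|\<close>, so \<open>|M|\<close> is a strict
  contraction in a weighted norm and the series converge absolutely.
\<close>

section \<open>Primitive words\<close>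

text \<open>The hypothesis controls |R|, but the trace series lives on \<open>M\<close>, whose
  weights satisfy |r'| >= |r| because the messages are nonnegative. Smallness therefore has to be
  carried from vertices to edges by an explicit weight. A Perron vector of |R| would not do: |R| may
  be reducible, and the vector may then have zero entries. The Neumann vector \<open>x\<close> has
  all entries at least 1, and the constant 1 in its equation is the source of every strict
  inequality.

  The product over orbits has no preferred order and is a limit along finite sets of orbits.
  Convergence of the trace series in the order of word length is thus not enough; the sum over all
  cyclic words must be unconditional before it is regrouped. In the regrouping, the power
  \<open>p^m\<close> of a primitive word of length \<open>l\<close> and weight \<open>w\<close>
  carries the coefficient 1/(m l). The \<open>l\<close> distinct rotations of \<open>p\<close>
  cancel 1/l, and summing over \<open>m\<close> leaves -ln(1 - w).\<close>

abbreviation lpow :: "'a list \<Rightarrow> nat \<Rightarrow> 'a list" where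
  "lpow p m \<equiv> concat (replicate m p)"

definition primitive_word :: "'a list \<Rightarrow> bool" where
  "primitive_word p \<longleftrightarrow> p \<noteq> [] \<and> (\<forall>q m. p = lpow q m \<longrightarrow> m = 1)"

lemma length_lpow: "length (lpow q m) = m * length q"
  by (induction m) auto

lemma lpow_add: "lpow q (a + b) = lpow q a @ lpow q b"
  by (simp add: replicate_add)

lemma lpow_commute: "q @ lpow q m = lpow q m @ q"
  by (induction m) auto

lemma lpow_lpow: "lpow (lpow q a) b = lpow q (a * b)"
  by (induction b) (auto simp: replicate_add)

lemma lpow_eq_Nil_iff: "lpow q m = [] \<longleftrightarrow> q = [] \<or> m = 0"
  by (induction m) auto

lemma hd_lpow: "m > 0 \<Longrightarrow> q \<noteq> [] \<Longrightarrow> hd (lpow q m) = hd q"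
  by (cases m) auto

lemma map_lpow: "map f (lpow q m) = lpow (map f q) m"
  by (induction m) auto

lemma set_lpow: "m > 0 \<Longrightarrow> set (lpow q m) = set q"
  by (cases m) auto

lemma zip_lpow: "length p = length q \<Longrightarrow> zip (lpow p m) (lpow q m) = lpow (zip p q) m"
  by (induction m) auto

lemma rotate1_lpow: "rotate1 (lpow q m) = lpow (rotate1 q) m"
proof (cases q)
  case (Cons a q')
  have "lpow (a # q') m @ [a] = a # lpow (q' @ [a]) m"
    by (induction m) auto
  then show ?thesis using Cons by (cases m) auto
qed (induction m, auto)

lemma rotate_lpow: "rotate k (lpow q m) = lpow (rotate k q) m"
  by (induction k) (auto simp: rotate1_lpow)

lemma primitive_root_exists:
  assumes "w \<noteq> []"
  shows "\<exists>p m. primitive_word p \<and> m > 0 \<and> w = lpow p m"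
  using assms
proof (induction "length w" arbitrary: w rule: less_induct)
  case less
  show ?case
  proof (cases "primitive_word w")
    case True
    then show ?thesis by (intro exI[of _ w] exI[of _ 1]) auto
  next
    case False
    then obtain q m where qm: "w = lpow q m" "m \<noteq> 1"
      using less.prems by (auto simp: primitive_word_def)
    with less.prems have "q \<noteq> []" "m \<noteq> 0" by (auto simp: lpow_eq_Nil_iff)
    with qm have "length q < length w" by (auto simp: length_lpow)
    from less.hyps[OF this \<open>q \<noteq> []\<close>] obtain p k where
      "primitive_word p" "k > 0" "q = lpow p k" by blast
    then show ?thesis using qm \<open>m \<noteq> 0\<close>
      by (intro exI[of _ p] exI[of _ "k * m"]) (auto simp: lpow_lpow)
  qed
qed

text \<open>Commuting words are powers of one common word, and a primitive word can only be its
  first power.\<close>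

lemma primitive_words_commute_imp_eq:
  assumes "primitive_word p" "primitive_word q" "p @ q = q @ p"
  shows "p = q"
  using assms comm_append_are_replicate[of p q] unfolding primitive_word_def
  by (metis (no_types))

text \<open>A weak form of the Fine-Wilf periodicity theorem. Unless \<open>n = 1\<close>, the
  common word has a prefix of length \<open>length p + length q\<close>, because \<open>p\<close> is
  the shorter root; this prefix reads both as \<open>p @ q\<close> and as \<open>q @ p\<close>, so
  the roots commute.\<close>

lemma primitive_root_unique_aux:
  assumes "primitive_word p" "primitive_word q" "lpow p m = lpow q n" "n > 0"
    "length p \<le> length q"
  shows "p = q"
proof (cases "n = 1")
  case True
  then have "q = lpow p m" using assms(3) by simp
  moreover from this have "m = 1" using assms(2) unfolding primitive_word_def by blast
  ultimately show ?thesis by simp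
next
  case False
  with assms(4) have "2 \<le> n" by simp
  let ?w = "lpow p m" and ?l = "length p + length q"
  have "?l \<le> 2 * length q" using assms(5) by simp
  also have "\<dots> \<le> n * length q" using \<open>2 \<le> n\<close> by simp
  also have "\<dots> = length ?w" using assms(3) by (simp add: length_lpow)
  finally have l: "?l \<le> length ?w" .
  obtain n' where n': "n = Suc n'" using assms(4) by (cases n) auto
  have "lpow p m \<noteq> []"
    unfolding assms(3) lpow_eq_Nil_iff using assms(2,4) by (simp add: primitive_word_def)
  then have "m \<noteq> 0" unfolding lpow_eq_Nil_iff by simp
  then obtain m' where m': "m = Suc m'" by (cases m) auto
  \<comment> \<open>Prepending a root to the common word is the same as appending it, and appending
    does not change a prefix that already fits.\<close>
  have "p @ q = take ?l (p @ lpow q n)" by (simp add: n')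
  also have "\<dots> = take ?l (?w @ p)" by (simp add: assms(3)[symmetric] lpow_commute)
  also have "\<dots> = take ?l ?w" using l by simp
  also have "\<dots> = take ?l (lpow q n @ q)" using l assms(3) by simp
  also have "\<dots> = take ?l (q @ ?w)" by (simp add: assms(3) lpow_commute)
  also have "\<dots> = q @ p" by (simp add: m')
  finally show ?thesis using primitive_words_commute_imp_eq assms(1,2) by blast
qed

lemma primitive_root_unique:
  assumes "primitive_word p" "primitive_word q" "lpow p m = lpow q n" "m > 0" "n > 0"
  shows "p = q \<and> m = n"
proof -
  have "p = q"
    using primitive_root_unique_aux[of p q m n] primitive_root_unique_aux[of q p n m] assms
    by (metis nat_le_linear)
  moreover from this have "m * length p = n * length p"
    using arg_cong[OF assms(3), of length] by (simp only: length_lpow)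
  ultimately show ?thesis using assms(1) by (auto simp: primitive_word_def)
qed

text \<open>Rotating a power rotates its base, and a further rotation undoes the first, so a power
  decomposition of the rotated word pulls back to \<open>p\<close>.\<close>

lemma primitive_word_rotate:
  assumes "primitive_word p"
  shows "primitive_word (rotate k p)"
  unfolding primitive_word_def
proof (intro conjI allI impI)
  show "rotate k p \<noteq> []" using assms by (simp add: primitive_word_def)
  fix q m assume "rotate k p = lpow q m"
  moreover define j where "j = length p - k mod length p"
  have "rotate j (rotate k p) = p"
  proof -
    have "rotate j (rotate k p) = rotate (j + k mod length p) p"
      by (metis rotate_rotate rotate_conv_mod)
    also have "j + k mod length p = length p"
      using assms by (auto simp: j_def primitive_word_def)
    finally show ?thesis by simp
  qed
  ultimately have "p = lpow (rotate j q) m" by (metis rotate_lpow)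
  then show "m = 1" using assms unfolding primitive_word_def by blast
qed

text \<open>A proper rotation fixing \<open>p\<close> makes its two nonempty pieces commute. Both
  are then positive powers of one word, and \<open>p\<close> is a power with exponent at least
  2.\<close>

lemma rotate_primitive_neq:
  assumes "primitive_word p" "0 < k" "k < length p"
  shows "rotate k p \<noteq> p"
proof
  assume "rotate k p = p"
  then have "drop k p @ take k p = take k p @ drop k p"
    using assms by (simp add: rotate_drop_take)
  then obtain a b z where z: "lpow z a = drop k p" "lpow z b = take k p"
    using comm_append_are_replicate by blast
  then have "p = lpow z (b + a)" by (simp only: lpow_add append_take_drop_id)
  then have "b + a = 1" using assms(1) unfolding primitive_word_def by blast
  moreover have "lpow z a \<noteq> []" "lpow z b \<noteq> []" unfolding z using assms by auto
  then have "a \<noteq> 0" "b \<noteq> 0" unfolding lpow_eq_Nil_iff by simp_all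
  ultimately show False by simp
qed

text \<open>This count cancels the factor 1/length that each word carries in the trace
  series.\<close>

lemma card_rotations_primitive:
  assumes "primitive_word p"
  shows "card (range (\<lambda>k. rotate k p)) = length p"
proof -
  have ne: "length p > 0" using assms by (simp add: primitive_word_def)
  have "range (\<lambda>k. rotate k p) = (\<lambda>k. rotate k p) ` {..<length p}"
  proof (intro equalityI subsetI)
    fix q assume "q \<in> range (\<lambda>k. rotate k p)"
    then obtain k where "q = rotate k p" by blast
    then have "q = rotate (k mod length p) p" by (metis rotate_conv_mod)
    then show "q \<in> (\<lambda>k. rotate k p) ` {..<length p}" using ne by auto
  qed auto
  moreover have "inj_on (\<lambda>k. rotate k p) {..<length p}"
  proof (rule linorder_inj_onI)
    fix a b assume ab: "a < b" "a \<in> {..<length p}" "b \<in> {..<length p}"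
    have "rotate b p = rotate (b - a) (rotate a p)" using ab by (simp add: rotate_rotate)
    also have "\<dots> \<noteq> rotate a p"
      using rotate_primitive_neq[OF primitive_word_rotate[OF assms]] ab by auto
    finally show "rotate a p \<noteq> rotate b p" by simp
  qed auto
  ultimately show ?thesis by (simp add: card_image)
qed

lemma zip_rotate1: "length xs = length ys \<Longrightarrow> zip (rotate1 xs) (rotate1 ys) = rotate1 (zip xs ys)"
  by (cases xs; cases ys) auto

section \<open>Orbits as rotation classes of primitive cyclic words\<close>

text \<open>Closed walks are kept as lists of steps, without the repeated end vertex, so that cyclic
  shifts become \<open>rotate\<close> and repetition becomes \<open>lpow\<close>. The last condition
  says that each step ends where its cyclic successor starts.\<close>

definition cyclic_path :: "real mat \<Rightarrow> (nat \<times> nat) list \<Rightarrow> bool" where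
  "cyclic_path R es \<longleftrightarrow> es \<noteq> [] \<and> set es \<subseteq> dir_edges R \<and> map snd es = rotate1 (map fst es)"

definition walk_of :: "(nat \<times> nat) list \<Rightarrow> nat list" where
  "walk_of es = fst (hd es) # map snd es"

text \<open>The pair of last and first step is included. Being a condition on the set of consecutive
  pairs, it is insensitive to rotations and to taking powers.\<close>

definition no_backtrack :: "(nat \<times> nat) list \<Rightarrow> bool" where
  "no_backtrack es \<longleftrightarrow> (\<forall>(e, f) \<in> set (zip es (rotate1 es)). f \<noteq> (snd e, fst e))"

lemma length_steps: "length (steps ws) = length ws - 1"
  by (simp add: steps_def)

lemma nth_steps: "t < length ws - 1 \<Longrightarrow> steps ws ! t = (ws ! t, ws ! (t + 1))"
  by (simp add: steps_def nth_tl)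

lemma steps_walk_of:
  assumes "cyclic_path R es"
  shows "steps (walk_of es) = es"
proof -
  obtain a es' where es: "es = a # es'"
    using assms by (cases es) (auto simp: cyclic_path_def)
  have "map snd es = map fst es' @ [fst a]"
    using assms by (simp add: cyclic_path_def es)
  then have "walk_of es = map fst es @ [fst a]"
    by (simp add: walk_of_def es)
  moreover have "tl (walk_of es) = map snd es" by (simp add: walk_of_def)
  ultimately have "steps (walk_of es) = zip (map fst es @ [fst a]) (map snd es @ [])"
    by (simp add: steps_def)
  also have "\<dots> = zip (map fst es) (map snd es)"
    by (subst zip_append) auto
  also have "\<dots> = es" by (rule zip_map_fst_snd)
  finally show ?thesis .
qed

lemma walk_of_steps:
  assumes "length ws \<ge> 2"
  shows "walk_of (steps ws) = ws"
proof -
  obtain w ws' where ws: "ws = w # ws'" "ws' \<noteq> []"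
    using assms by (cases ws; cases "tl ws") auto
  then have "steps ws = zip (w # ws') ws'" by (simp add: steps_def)
  moreover from this ws have "hd (steps ws) = (w, hd ws')"
    by (cases ws') auto
  ultimately show ?thesis using ws by (simp add: walk_of_def map_snd_zip_take)
qed

text \<open>Every vertex is an endpoint of a step, the last one of the final step; a walk with a
  single vertex has no step that could constrain it.\<close>

lemma is_walk_iff_steps:
  assumes "length ws \<ge> 2"
  shows "is_walk R ws \<longleftrightarrow> set (steps ws) \<subseteq> dir_edges R"
proof
  assume w: "is_walk R ws"
  show "set (steps ws) \<subseteq> dir_edges R"
  proof
    fix e assume "e \<in> set (steps ws)"
    then obtain t where t: "t < length ws - 1" "e = steps ws ! t"
      by (auto simp: in_set_conv_nth length_steps)
    then have "ws ! t \<in> set ws" "ws ! (t + 1) \<in> set ws" by auto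
    then have "ws ! t < dim_row R" "ws ! (t + 1) < dim_row R"
      using w by (auto simp: is_walk_def)
    then show "e \<in> dir_edges R"
      using t w by (auto simp: nth_steps dir_edges_def is_walk_def)
  qed
next
  assume s: "set (steps ws) \<subseteq> dir_edges R"
  have d: "(ws ! t, ws ! (t + 1)) \<in> dir_edges R" if "t < length ws - 1" for t
  proof -
    have "steps ws ! t \<in> set (steps ws)"
      using that by (simp add: length_steps)
    then have "steps ws ! t \<in> dir_edges R" using s by blast
    then show ?thesis using that by (simp add: nth_steps)
  qed
  have "w < dim_row R" if w: "w \<in> set ws" for w
  proof -
    obtain t where t: "t < length ws" "w = ws ! t"
      using w by (auto simp: in_set_conv_nth)
    show ?thesis
    proof (cases "t < length ws - 1")
      case True
      then show ?thesis using d[of t] t by (auto simp: dir_edges_def)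
    next
      case False
      then show ?thesis using d[of "t - 1"] t assms by (auto simp: dir_edges_def)
    qed
  qed
  then show "is_walk R ws"
    using d assms by (auto simp: is_walk_def dir_edges_def)
qed

lemma cyclic_path_steps:
  assumes "is_closed_walk R ws"
  shows "cyclic_path R (steps ws)"
proof -
  have l: "length ws \<ge> 2" and hl: "hd ws = last ws" and w: "is_walk R ws"
    using assms by (auto simp: is_closed_walk_def)
  obtain w ws' where ws: "ws = w # ws'" "ws' \<noteq> []"
    using l by (cases ws; cases "tl ws") auto
  have st: "steps ws = zip (w # ws') ws'" using ws by (simp add: steps_def)
  have "last ws' = w" using ws hl by simp
  then have "ws' = butlast ws' @ [w]" using ws append_butlast_last_id by metis
  then have "steps ws = zip ((w # butlast ws') @ [w]) (ws' @ [])" using st by simp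
  also have "\<dots> = zip (w # butlast ws') ws'"
    using ws by (subst zip_append) auto
  finally have "map fst (steps ws) = w # butlast ws'" "map snd (steps ws) = ws'"
    using ws by auto
  then have "map snd (steps ws) = rotate1 (map fst (steps ws))"
    using \<open>ws' = butlast ws' @ [w]\<close> by simp
  moreover have "steps ws \<noteq> []" using length_steps[of ws] l by auto
  ultimately show ?thesis
    using is_walk_iff_steps[OF l] w by (simp add: cyclic_path_def)
qed

lemma is_closed_walk_walk_of:
  assumes "cyclic_path R es"
  shows "is_closed_walk R (walk_of es)"
proof -
  obtain a es' where es: "es = a # es'"
    using assms by (cases es) (auto simp: cyclic_path_def)
  have l: "length (walk_of es) \<ge> 2" by (simp add: walk_of_def es)
  have "map snd es = map fst es' @ [fst a]"
    using assms by (simp add: cyclic_path_def es)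
  then have "last (map snd es) = fst a" by (metis last_snoc)
  then have "hd (walk_of es) = last (walk_of es)"
    by (simp add: walk_of_def es)
  moreover have "is_walk R (walk_of es)"
    using is_walk_iff_steps[OF l] steps_walk_of[OF assms] assms by (simp add: cyclic_path_def)
  ultimately show ?thesis using l by (simp add: is_closed_walk_def)
qed

lemma lpow_eq_iff:
  assumes "length p = length q" "m > 0"
  shows "lpow p m = lpow q m \<longleftrightarrow> p = q"
  using assms by (cases m) auto

lemma cyclic_path_lpow:
  assumes "m > 0"
  shows "cyclic_path R (lpow q m) \<longleftrightarrow> cyclic_path R q"
  unfolding cyclic_path_def lpow_eq_Nil_iff set_lpow[OF assms] map_lpow rotate1_lpow
  using assms by (subst lpow_eq_iff) auto

text \<open>Consecutive copies in \<open>walk_pow\<close> share an endpoint, which disappears in the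
  list of steps, so \<open>walk_pow\<close> turns into \<open>lpow\<close>. The base of a power with
  exponent at least 2 is automatically shorter, as the length clause of \<open>is_primitive\<close>
  asks.\<close>

lemma is_primitive_iff:
  "is_primitive R ws \<longleftrightarrow> is_closed_walk R ws \<and> primitive_word (steps ws)"
proof (intro iffI conjI)
  assume p: "is_primitive R ws"
  then show c: "is_closed_walk R ws" by (simp add: is_primitive_def)
  have l: "length ws \<ge> 2" using c by (simp add: is_closed_walk_def)
  note cs = cyclic_path_steps[OF c]
  show "primitive_word (steps ws)"
    unfolding primitive_word_def
  proof (intro conjI allI impI)
    show ne: "steps ws \<noteq> []" using cs by (simp add: cyclic_path_def)
    fix q m assume qm: "steps ws = lpow q m"
    have qm0: "q \<noteq> []" "m > 0" using ne unfolding qm lpow_eq_Nil_iff by auto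
    show "m = 1"
    proof (rule ccontr)
      assume "m \<noteq> 1"
      with qm0 have m2: "m \<ge> 2" by simp
      have "cyclic_path R q" using cs qm0(2) unfolding qm by (simp only: cyclic_path_lpow)
      then have "is_closed_walk R (walk_of q)" by (rule is_closed_walk_walk_of)
      moreover have "ws = walk_pow (walk_of q) m"
      proof -
        have "ws = walk_of (lpow q m)" using walk_of_steps[OF l] qm by metis
        then show ?thesis
          unfolding walk_of_def walk_pow_def hd_lpow[OF qm0(2,1)] map_lpow by simp
      qed
      moreover have "length (walk_of q) < length ws"
      proof -
        have "length (steps ws) = m * length q" unfolding qm by (rule length_lpow)
        then have "length ws = Suc (m * length q)" using l by (simp add: length_steps)
        then show ?thesis using m2 qm0 by (simp add: walk_of_def)
      qed
      ultimately show False using p m2 unfolding is_primitive_def by blast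
    qed
  qed
next
  assume a: "is_closed_walk R ws \<and> primitive_word (steps ws)"
  have "False" if m: "m \<ge> 2" and c: "is_closed_walk R c" and ws: "ws = walk_pow c m" for c m
  proof -
    have lc: "length c \<ge> 2" using c by (simp add: is_closed_walk_def)
    let ?q = "steps c"
    have cq: "cyclic_path R ?q" by (rule cyclic_path_steps[OF c])
    have "c = walk_of ?q" using walk_of_steps[OF lc] by simp
    then have hdtl: "hd c = fst (hd ?q)" "tl c = map snd ?q"
      by (metis walk_of_def list.sel(1), metis walk_of_def list.sel(3))
    have "?q \<noteq> []" using cq by (simp add: cyclic_path_def)
    moreover have "m > 0" using m by simp
    ultimately have "hd (lpow ?q m) = hd ?q" by (intro hd_lpow)
    then have "ws = walk_of (lpow ?q m)"
      unfolding ws walk_pow_def walk_of_def hdtl map_lpow by (simp only:)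
    moreover have "cyclic_path R (lpow ?q m)"
      using cq \<open>m > 0\<close> by (simp only: cyclic_path_lpow)
    ultimately have "steps ws = lpow ?q m" by (simp only: steps_walk_of)
    then have "m = 1" using a unfolding primitive_word_def by blast
    then show False using m by simp
  qed
  then show "is_primitive R ws" using a unfolding is_primitive_def by blast
qed

lemma cyclic_path_rotate: "cyclic_path R (rotate k es) \<longleftrightarrow> cyclic_path R es"
proof -
  have "cyclic_path R (rotate1 es) \<longleftrightarrow> cyclic_path R es" for es
    by (simp add: cyclic_path_def rotate1_map[symmetric] inj_eq[OF inj_rotate1])
  then show ?thesis by (induction k) auto
qed

lemma set_zip_rotate:
  "set (zip (rotate k es) (rotate1 (rotate k es))) = set (zip es (rotate1 es))"
proof (induction k)
  case (Suc k)
  then show ?case by (simp add: zip_rotate1)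
qed simp

lemma no_backtrack_rotate: "no_backtrack (rotate k es) \<longleftrightarrow> no_backtrack es"
  by (simp only: no_backtrack_def set_zip_rotate)

lemma no_backtrack_lpow: "m > 0 \<Longrightarrow> no_backtrack (lpow q m) \<longleftrightarrow> no_backtrack q"
  unfolding no_backtrack_def rotate1_lpow by (subst zip_lpow) (simp_all only: set_lpow length_rotate1)

lemma range_rotate_rotate:
  "range (\<lambda>k. rotate k (rotate j p)) = range (\<lambda>k. rotate k p)"
proof (cases "p = []")
  case False
  show ?thesis
  proof (intro equalityI subsetI)
    fix q assume "q \<in> range (\<lambda>k. rotate k p)"
    then obtain k where k: "q = rotate k p" by blast
    have l: "j mod length p < length p" using False by simp
    \<comment> \<open>The complement of \<open>j\<close> modulo the length realises rotation by
      \<open>k - j\<close> with a natural number.\<close>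
    have "q = rotate (k + (length p - j mod length p)) (rotate j p)"
    proof -
      have "rotate (k + (length p - j mod length p)) (rotate j p)
          = rotate (k + (length p - j mod length p)) (rotate (j mod length p) p)"
        by (metis rotate_conv_mod)
      also have "\<dots> = rotate (k + (length p - j mod length p) + j mod length p) p"
        by (rule rotate_rotate)
      also have "k + (length p - j mod length p) + j mod length p = k + length p"
        using l by simp
      also have "rotate (k + length p) p = rotate k p"
        by (metis rotate_conv_mod mod_add_self2)
      finally show ?thesis using k by simp
    qed
    then show "q \<in> range (\<lambda>k. rotate k (rotate j p))" by blast
  qed (auto simp: rotate_rotate)
qed auto

text \<open>Every member of the orbit serves as representative, so the choice made by
  \<open>SOME\<close> in \<open>orbit_steps\<close> is immaterial. The second conclusion recovers
  the orbit from one representative, which is what injectivity of the later reindexing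
  needs.\<close>

lemma steps_image_orbit:
  assumes "\<gamma> \<in> orbits R" "p \<in> steps ` \<gamma>"
  shows "steps ` \<gamma> = range (\<lambda>k. rotate k p)"
    and "\<gamma> = {ws. is_primitive R ws \<and> steps ws \<in> range (\<lambda>k. rotate k p)}"
    and "primitive_word p" and "cyclic_path R p"
proof -
  obtain ws where ws: "is_primitive R ws" "\<gamma> = {ws'. is_primitive R ws' \<and> cyc_equiv ws ws'}"
    using assms by (auto simp: orbits_def)
  obtain j where j: "p = rotate j (steps ws)"
    using assms(2) ws by (auto simp: cyc_equiv_def)
  have r: "range (\<lambda>k. rotate k p) = range (\<lambda>k. rotate k (steps ws))"
    unfolding j by (rule range_rotate_rotate)
  show g: "\<gamma> = {ws. is_primitive R ws \<and> steps ws \<in> range (\<lambda>k. rotate k p)}"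
    unfolding r by (auto simp: ws(2) cyc_equiv_def)
  show pp: "primitive_word p" using ws(1) unfolding j is_primitive_iff
    by (simp add: primitive_word_rotate)
  show cp: "cyclic_path R p" using ws(1) unfolding j is_primitive_iff cyclic_path_rotate
    by (simp add: cyclic_path_steps)
  show "steps ` \<gamma> = range (\<lambda>k. rotate k p)"
  proof (intro equalityI subsetI)
    fix q assume "q \<in> range (\<lambda>k. rotate k p)"
    then obtain k where k: "q = rotate k p" by blast
    then have "cyclic_path R q" "primitive_word q"
      using pp cp by (simp_all add: cyclic_path_rotate primitive_word_rotate)
    then have "is_primitive R (walk_of q)" "steps (walk_of q) = q"
      by (simp_all add: is_primitive_iff is_closed_walk_walk_of steps_walk_of)
    then have "walk_of q \<in> \<gamma>" "steps (walk_of q) = q" using k unfolding g by auto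
    then show "q \<in> steps ` \<gamma>" by force
  qed (use g in blast)
qed

lemma orbit_steps_mem:
  assumes "\<gamma> \<in> orbits R"
  shows "orbit_steps \<gamma> \<in> steps ` \<gamma>"
proof -
  obtain ws where ws: "is_primitive R ws" "\<gamma> = {ws'. is_primitive R ws' \<and> cyc_equiv ws ws'}"
    using assms by (auto simp: orbits_def)
  have "cyc_equiv ws ws" unfolding cyc_equiv_def by (rule exI[of _ 0]) simp
  then have "ws \<in> \<gamma>" using ws by simp
  then show ?thesis unfolding orbit_steps_def by (metis someI imageI)
qed

lemma backtrackless_iff:
  assumes "\<gamma> \<in> orbits R" "p \<in> steps ` \<gamma>"
  shows "backtrackless \<gamma> \<longleftrightarrow> no_backtrack p"
proof -
  let ?s = "orbit_steps \<gamma>"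
  have "backtrackless \<gamma> \<longleftrightarrow> no_backtrack ?s"
  proof -
    have "no_backtrack ?s \<longleftrightarrow> list_all2 (\<lambda>e f. f \<noteq> (snd e, fst e)) ?s (rotate1 ?s)"
      by (simp add: no_backtrack_def list_all2_iff)
    then show ?thesis
      by (simp add: backtrackless_def Let_def list_all2_conv_all_nth nth_rotate1)
  qed
  moreover obtain k where "?s = rotate k p"
    using orbit_steps_mem[OF assms(1)] steps_image_orbit(1)[OF assms] by auto
  ultimately show ?thesis by (simp add: no_backtrack_rotate)
qed

lemma prod_power_count_list:
  fixes u :: "'a \<Rightarrow> 'b::comm_monoid_mult"
  assumes "finite A" "set xs \<subseteq> A"
  shows "(\<Prod>a\<in>A. u a ^ count_list xs a) = prod_list (map u xs)"
  using assms(2)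
proof (induction xs)
  case (Cons x xs)
  have "(\<Prod>a\<in>A. u a ^ count_list (x # xs) a)
      = (\<Prod>a\<in>A. (if a = x then u a else 1) * u a ^ count_list xs a)"
    by (rule prod.cong) auto
  also have "\<dots> = (\<Prod>a\<in>A. if a = x then u a else 1) * (\<Prod>a\<in>A. u a ^ count_list xs a)"
    by (rule prod.distrib)
  also have "(\<Prod>a\<in>A. if a = x then u a else 1) = u x"
    using Cons.prems assms(1) by (simp add: prod.delta)
  finally show ?case using Cons by simp
qed simp

lemma finite_dir_edges: "finite (dir_edges R)"
  by (rule finite_subset[of _ "{..<dim_row R} \<times> {..<dim_row R}"]) (auto simp: dir_edges_def)

lemma prod_list_map_rotate:
  fixes u :: "'a \<Rightarrow> 'b::comm_monoid_mult"
  shows "prod_list (map u (rotate k xs)) = prod_list (map u xs)"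
proof -
  have "prod_list (map u (rotate1 xs)) = prod_list (map u xs)" for xs
    by (cases xs) (auto simp: mult.commute)
  then show ?thesis by (induction k) auto
qed

lemma orbit_weight_eq:
  assumes "\<gamma> \<in> orbits R" "p \<in> steps ` \<gamma>"
  shows "orbit_weight R \<gamma> = prod_list (map (\<lambda>(i, j). r_prime R i j) p)"
proof -
  let ?s = "orbit_steps \<gamma>"
  obtain k where k: "?s = rotate k p"
    using orbit_steps_mem[OF assms(1)] steps_image_orbit(1)[OF assms] by auto
  have "set ?s \<subseteq> dir_edges R" using steps_image_orbit(4)[OF assms] k by (simp add: cyclic_path_def)
  then have "orbit_weight R \<gamma> = prod_list (map (\<lambda>(i, j). r_prime R i j) ?s)"
    unfolding orbit_weight_def n_step_def
    by (subst prod_power_count_list[OF finite_dir_edges, symmetric]) (auto intro!: prod.cong)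
  then show ?thesis by (simp add: k prod_list_map_rotate)
qed

text \<open>Reindexes backtrackless closed words by orbit, rotation and exponent. Injectivity is
  uniqueness of the primitive root, which in turn determines its orbit. For surjectivity, the root
  of a word inherits closedness and absence of backtracking, since neither is affected by
  powers.\<close>

lemma bij_betw_orbit_powers:
  "bij_betw (\<lambda>((\<gamma>, p), m). lpow p m)
     (SIGMA x:(SIGMA \<gamma>:backtrackless_orbits R. steps ` \<gamma>). {1..})
     {es. cyclic_path R es \<and> no_backtrack es}"
  unfolding bij_betw_def
proof (intro conjI)
  let ?S = "SIGMA x:(SIGMA \<gamma>:backtrackless_orbits R. steps ` \<gamma>). {1::nat..}"
  have eq: "\<gamma> = \<gamma>' \<and> p = p' \<and> m = m'" if "\<gamma> \<in> backtrackless_orbits R" "p \<in> steps ` \<gamma>"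
    "\<gamma>' \<in> backtrackless_orbits R" "p' \<in> steps ` \<gamma>'" "m \<ge> 1" "m' \<ge> 1" "lpow p m = lpow p' m'"
    for \<gamma> \<gamma>' p p' and m m' :: nat
  proof -
    have o: "\<gamma> \<in> orbits R" "\<gamma>' \<in> orbits R" using that by (auto simp: backtrackless_orbits_def)
    have "p = p' \<and> m = m'"
      using steps_image_orbit(3)[OF o(1) that(2)] steps_image_orbit(3)[OF o(2) that(4)] that(5-7)
      by (intro primitive_root_unique) auto
    moreover from this have "\<gamma> = \<gamma>'"
      using steps_image_orbit(2)[OF o(1) that(2)] steps_image_orbit(2)[OF o(2) that(4)] by simp
    ultimately show ?thesis by simp
  qed
  show "inj_on (\<lambda>((\<gamma>, p), m). lpow p m) ?S"
    by (rule inj_onI) (clarsimp, use eq in \<open>metis imageI One_nat_def\<close>)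
  show "(\<lambda>((\<gamma>, p), m). lpow p m) ` ?S = {es. cyclic_path R es \<and> no_backtrack es}"
  proof (intro equalityI subsetI)
    fix es assume "es \<in> (\<lambda>((\<gamma>, p), m). lpow p m) ` ?S"
    then obtain \<gamma> p m where *: "\<gamma> \<in> backtrackless_orbits R" "p \<in> steps ` \<gamma>" "m \<ge> 1" "es = lpow p m"
      by auto
    then have o: "\<gamma> \<in> orbits R" "backtrackless \<gamma>" and m: "m > 0"
      by (auto simp: backtrackless_orbits_def)
    have "no_backtrack p" using backtrackless_iff[OF o(1) *(2)] o(2) by simp
    moreover have "cyclic_path R p" by (rule steps_image_orbit(4)[OF o(1) *(2)])
    ultimately show "es \<in> {es. cyclic_path R es \<and> no_backtrack es}"
      unfolding mem_Collect_eq *(4) cyclic_path_lpow[OF m] no_backtrack_lpow[OF m] by simp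
  next
    fix es assume es: "es \<in> {es. cyclic_path R es \<and> no_backtrack es}"
    then have "es \<noteq> []" by (simp add: cyclic_path_def)
    then obtain p m where p: "primitive_word p" and m: "m > 0" and pm: "es = lpow p m"
      using primitive_root_exists by blast
    have c: "cyclic_path R p" and nb: "no_backtrack p"
      using es unfolding pm mem_Collect_eq cyclic_path_lpow[OF m] no_backtrack_lpow[OF m] by simp_all
    define \<gamma> where "\<gamma> = {ws'. is_primitive R ws' \<and> cyc_equiv (walk_of p) ws'}"
    have prim: "is_primitive R (walk_of p)"
      using p c by (simp add: is_primitive_iff is_closed_walk_walk_of steps_walk_of)
    then have o: "\<gamma> \<in> orbits R" by (auto simp: orbits_def \<gamma>_def)
    have "cyc_equiv (walk_of p) (walk_of p)" unfolding cyc_equiv_def by (rule exI[of _ 0]) simp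
    then have "walk_of p \<in> \<gamma>" using prim by (simp add: \<gamma>_def)
    then have pg: "p \<in> steps ` \<gamma>" using steps_walk_of[OF c] by force
    have "\<gamma> \<in> backtrackless_orbits R"
      using o nb backtrackless_iff[OF o pg] by (simp add: backtrackless_orbits_def)
    then have "((\<gamma>, p), m) \<in> ?S" using pg m by auto
    then show "es \<in> (\<lambda>((\<gamma>, p), m). lpow p m) ` ?S" unfolding pm by (rule rev_image_eqI) simp
  qed
qed

section \<open>Traces of powers and the determinant\<close>

definition mat_trace :: "'a::comm_monoid_add mat \<Rightarrow> 'a" where
  "mat_trace A = (\<Sum>i<dim_row A. A $$ (i, i))"

lemma index_mult_mat_sum:
  assumes "A \<in> carrier_mat n m" "B \<in> carrier_mat m k" "i < n" "j < k"
  shows "(A * B) $$ (i, j) = (\<Sum>c<m. A $$ (i, c) * B $$ (c, j))"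
  using assms by (auto simp: scalar_prod_def lessThan_atLeast0)

lemma mat_trace_mult_commute:
  fixes A B :: "'a::comm_semiring_0 mat"
  assumes "A \<in> carrier_mat n m" "B \<in> carrier_mat m n"
  shows "mat_trace (A * B) = mat_trace (B * A)"
proof -
  have "mat_trace (A * B) = (\<Sum>i<n. \<Sum>c<m. A $$ (i, c) * B $$ (c, i))"
    using assms by (auto simp: mat_trace_def index_mult_mat_sum simp del: index_mult_mat(1) intro!: sum.cong)
  also have "\<dots> = (\<Sum>c<m. \<Sum>i<n. B $$ (c, i) * A $$ (i, c))"
    by (subst sum.swap) (simp add: mult.commute)
  also have "\<dots> = mat_trace (B * A)"
    using assms by (auto simp: mat_trace_def index_mult_mat_sum simp del: index_mult_mat(1) intro!: sum.cong)
  finally show ?thesis .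
qed

lemma mat_trace_similar:
  fixes A B :: "'a::comm_ring_1 mat"
  assumes A: "A \<in> carrier_mat n n" and s: "similar_mat_wit A B P Q"
  shows "mat_trace A = mat_trace B"
proof -
  note D = similar_mat_witD2[OF A s]
  have "mat_trace A = mat_trace (P * (B * Q))"
    unfolding D(3) assoc_mult_mat[OF D(6,5,7)] ..
  also have "\<dots> = mat_trace (B * Q * P)"
    using D(5-7) by (intro mat_trace_mult_commute[of _ n n]) auto
  also have "B * Q * P = B"
    unfolding assoc_mult_mat[OF D(5,7,6)] D(2) using D(5) by simp
  finally show ?thesis .
qed

text \<open>The zeros below the diagonal must be carried through the induction, since they are what
  makes diagonal entries multiply.\<close>

lemma upper_triangular_pow:
  fixes B :: "'a::comm_semiring_1 mat"
  assumes B: "B \<in> carrier_mat n n" and ut: "upper_triangular B" and ij: "i < n" "j \<le> i"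
  shows "(B ^\<^sub>m k) $$ (i, j) = (if i = j then (B $$ (i, i)) ^ k else 0)"
  using ij
proof (induction k arbitrary: j)
  case 0
  then show ?case using B by simp
next
  case (Suc k)
  have Bk: "B ^\<^sub>m k \<in> carrier_mat n n" using B by simp
  have "(B ^\<^sub>m Suc k) $$ (i, j) = (\<Sum>c<n. (B ^\<^sub>m k) $$ (i, c) * B $$ (c, j))"
    using index_mult_mat_sum[OF Bk B] Suc.prems by simp
  also have "\<dots> = (\<Sum>c<n. if c = i then (if i = j then B $$ (i, i) ^ Suc k else 0) else 0)"
  proof (rule sum.cong)
    fix c assume c: "c \<in> {..<n}"
    consider "c < i" | "c = i" | "c > i" by linarith
    then show "(B ^\<^sub>m k) $$ (i, c) * B $$ (c, j)
      = (if c = i then (if i = j then B $$ (i, i) ^ Suc k else 0) else 0)"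
    proof cases
      case 1 then show ?thesis using Suc.IH[of c] Suc.prems by simp
    next
      case 2 then show ?thesis
        using Suc.IH[of i] Suc.prems upper_triangularD[OF ut, of j i] B
        by (cases "j = i") (auto simp: mult.commute)
    next
      case 3 then show ?thesis using upper_triangularD[OF ut, of j c] B c Suc.prems by auto
    qed
  qed simp
  also have "\<dots> = (if i = j then B $$ (i, i) ^ Suc k else 0)" using Suc.prems by (simp add: sum.delta)
  finally show ?case .
qed

lemma similar_mat_one_minus:
  fixes A B :: "'a::comm_ring_1 mat"
  assumes A: "A \<in> carrier_mat n n" and s: "similar_mat_wit A B P Q"
  shows "similar_mat (1\<^sub>m n - A) (1\<^sub>m n - B)"
proof -
  note D = similar_mat_witD2[OF A s]
  have "P * (1\<^sub>m n - B) * Q = P * Q - P * B * Q"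
    using D(5-7) by (simp add: mult_minus_distrib_mat[of P n n _ n] minus_mult_distrib_mat[of _ n n _ _ n])
  then have "P * (1\<^sub>m n - B) * Q = 1\<^sub>m n - A" unfolding D(1) D(3)[symmetric] .
  then have "similar_mat_wit (1\<^sub>m n - A) (1\<^sub>m n - B) P Q"
    using D(1,2,4-7) by (intro similar_mat_witI[of _ _ n]) auto
  then show ?thesis by (auto simp: similar_mat_def)
qed

text \<open>Schur triangularisation puts the roots of the characteristic polynomial on the diagonal,
  where traces of powers and the determinant can be read off. The list \<open>es\<close> keeps
  multiplicities.\<close>

lemma complex_trace_and_det_via_eigenvalues:
  fixes C :: "complex mat"
  assumes C: "C \<in> carrier_mat n n"
  obtains es where "\<And>k. mat_trace (C ^\<^sub>m k) = (\<Sum>e\<leftarrow>es. e ^ k)"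
    and "det (1\<^sub>m n - C) = (\<Prod>e\<leftarrow>es. 1 - e)"
    and "\<And>e. e \<in> set es \<Longrightarrow> eigenvalue C e"
proof -
  obtain es where es: "char_poly C = (\<Prod>e\<leftarrow>es. [:- e, 1:])" "length es = n"
    using char_poly_factorized[OF C] by blast
  obtain B P Q where "schur_decomposition C es = (B, P, Q)" by (cases "schur_decomposition C es") auto
  from schur_decomposition[OF C es(1) this]
  have s: "similar_mat_wit C B P Q" and ut: "upper_triangular B" and dg: "diag_mat B = es" by auto
  have B: "B \<in> carrier_mat n n" using similar_mat_witD2[OF C s] by simp
  have sum_es: "(\<Sum>e\<leftarrow>es. f e) = (\<Sum>i<n. f (B $$ (i, i)))" for f :: "complex \<Rightarrow> complex"
    using B by (simp add: dg[symmetric] diag_mat_def comp_def sum_list_sum_nth lessThan_atLeast0)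
  have "mat_trace (C ^\<^sub>m k) = (\<Sum>e\<leftarrow>es. e ^ k)" for k
  proof -
    have "mat_trace (C ^\<^sub>m k) = mat_trace (B ^\<^sub>m k)"
      by (rule mat_trace_similar[OF pow_carrier_mat[OF C] similar_mat_wit_pow[OF s]])
    also have "\<dots> = (\<Sum>i<n. (B $$ (i, i)) ^ k)"
      using B upper_triangular_pow[OF B ut] by (simp add: mat_trace_def)
    finally show ?thesis by (simp add: sum_es)
  qed
  moreover have "det (1\<^sub>m n - C) = (\<Prod>e\<leftarrow>es. 1 - e)"
  proof -
    have "det (1\<^sub>m n - C) = det (1\<^sub>m n - B)" by (rule det_similar[OF similar_mat_one_minus[OF C s]])
    also have "\<dots> = prod_list (diag_mat (1\<^sub>m n - B))"
      using B ut by (intro det_upper_triangular) (auto simp: upper_triangular_def)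
    also have "diag_mat (1\<^sub>m n - B) = map (\<lambda>e. 1 - e) es"
      using B by (auto simp: dg[symmetric] diag_mat_def)
    finally show ?thesis by simp
  qed
  moreover have "eigenvalue C e" if "e \<in> set es" for e
    using that unfolding eigenvalue_root_char_poly[OF C] es(1) by (auto simp: poly_prod_list prod_list_zero_iff)
  ultimately show ?thesis by (rule that)
qed

text \<open>The column hypothesis says that \<open>C\<close> has operator norm at most \<theta> for
  the weighted norm \<open>S\<close> of a vector, the sum of \<open>v i * |z i|\<close>. An
  eigenvector is stretched by \<open>cmod e\<close> in this norm.\<close>

lemma eigenvalue_norm_le:
  fixes C :: "complex mat" and v :: "nat \<Rightarrow> real"
  assumes C: "C \<in> carrier_mat n n" and v: "\<And>i. i < n \<Longrightarrow> v i > 0"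
    and bd: "\<And>j. j < n \<Longrightarrow> (\<Sum>i<n. v i * cmod (C $$ (i, j))) \<le> \<theta> * v j"
    and ev: "eigenvalue C e"
  shows "cmod e \<le> \<theta>"
proof -
  obtain z where z: "z \<in> carrier_vec n" "z \<noteq> 0\<^sub>v n" "C *\<^sub>v z = e \<cdot>\<^sub>v z"
    using ev C by (auto simp: eigenvalue_def eigenvector_def)
  obtain i0 where i0: "i0 < n" "vec_index z i0 \<noteq> 0" using z(1,2) eq_vecI[of z "0\<^sub>v n"] by auto
  define S where "S = (\<Sum>i<n. v i * cmod (vec_index z i))"
  have "S > 0" unfolding S_def
    by (rule sum_pos2[of _ i0]) (use v i0 in \<open>auto intro!: mult_nonneg_nonneg intro: less_imp_le\<close>)
  have row: "cmod e * cmod (vec_index z i) \<le> (\<Sum>j<n. cmod (C $$ (i, j)) * cmod (vec_index z j))" if "i < n" for i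
  proof -
    have "e * vec_index z i = (\<Sum>j<n. C $$ (i, j) * vec_index z j)"
      using arg_cong[OF z(3), of "\<lambda>w. vec_index w i"] that C z(1)
      by (simp add: scalar_prod_def lessThan_atLeast0)
    then have "cmod e * cmod (vec_index z i) = cmod (\<Sum>j<n. C $$ (i, j) * vec_index z j)"
      by (metis norm_mult)
    also have "\<dots> \<le> (\<Sum>j<n. cmod (C $$ (i, j) * vec_index z j))" by (rule norm_sum)
    finally show ?thesis by (simp add: norm_mult)
  qed
  have "cmod e * S = (\<Sum>i<n. v i * (cmod e * cmod (vec_index z i)))"
    by (simp add: S_def sum_distrib_left mult_ac)
  also have "\<dots> \<le> (\<Sum>i<n. v i * (\<Sum>j<n. cmod (C $$ (i, j)) * cmod (vec_index z j)))"
    using row v by (intro sum_mono mult_left_mono) (auto intro: less_imp_le)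
  also have "\<dots> = (\<Sum>j<n. (\<Sum>i<n. v i * cmod (C $$ (i, j))) * cmod (vec_index z j))"
    by (simp add: sum_distrib_left sum_distrib_right mult_ac) (rule sum.swap)
  also have "\<dots> \<le> (\<Sum>j<n. (\<theta> * v j) * cmod (vec_index z j))"
    using bd by (intro sum_mono mult_right_mono) auto
  also have "\<dots> = \<theta> * S" by (simp add: S_def sum_distrib_left mult_ac)
  finally show ?thesis using \<open>S > 0\<close> by simp
qed

lemma sums_sum_list:
  fixes f :: "'a \<Rightarrow> nat \<Rightarrow> 'b::{topological_comm_monoid_add,t2_space}"
  assumes "\<And>x. x \<in> set xs \<Longrightarrow> f x sums s x"
  shows "(\<lambda>k. \<Sum>x\<leftarrow>xs. f x k) sums (\<Sum>x\<leftarrow>xs. s x)"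
  using assms by (induction xs) (auto intro: sums_add)

lemma neg_Ln_one_minus_sums:
  fixes z :: complex
  assumes "cmod z < 1"
  shows "(\<lambda>k. z ^ Suc k / of_nat (Suc k)) sums (- Ln (1 - z))"
proof -
  have "(\<lambda>n. - (- ((- (- z)) ^ n) / of_nat n)) sums (- Ln (1 + - z))"
    by (intro sums_minus Ln_series') (use assms in simp)
  then have "(\<lambda>n. z ^ n / of_nat n) sums (- Ln (1 - z))" by simp
  \<comment> \<open>Shifting the index costs nothing: the term at 0 is a division by zero, hence
    zero.\<close>
  then show ?thesis using sums_Suc_iff[of "\<lambda>n. z ^ n / of_nat n" "- Ln (1 - z)"] by simp
qed

lemma exp_sum_list_neg_Ln:
  assumes "\<And>e. e \<in> set es \<Longrightarrow> cmod e < 1"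
  shows "exp (\<Sum>e\<leftarrow>es. - Ln (1 - e)) = inverse (\<Prod>e\<leftarrow>es. 1 - e)"
  using assms
proof (induction es)
  case (Cons e es)
  have "1 - e \<noteq> 0" using Cons.prems[of e] by auto
  then have "exp (- Ln (1 - e)) = inverse (1 - e)" by (simp add: exp_minus)
  moreover have "exp (\<Sum>e\<leftarrow>es. - Ln (1 - e)) = inverse (\<Prod>e\<leftarrow>es. 1 - e)"
    using Cons by simp
  ultimately show ?case by (simp add: exp_add[of "- Ln (1 - e)", simplified])
qed simp

text \<open>This is -ln det(I - A) expanded eigenvalue by eigenvalue. The eigenvalues are complex,
  so the series is summed there and brought back to the reals; only exponentials of the logarithms
  are compared, so no branch has to be tracked.\<close>

lemma trace_log_series:
  fixes A :: "real mat" and v :: "nat \<Rightarrow> real"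
  assumes A: "A \<in> carrier_mat n n" and v: "\<And>i. i < n \<Longrightarrow> v i > 0"
    and bd: "\<And>j. j < n \<Longrightarrow> (\<Sum>i<n. v i * \<bar>A $$ (i, j)\<bar>) \<le> \<theta> * v j" and \<theta>: "\<theta> < 1"
  obtains L where "(\<lambda>k. mat_trace (A ^\<^sub>m Suc k) / real (Suc k)) sums L"
    and "exp L = inverse (det (1\<^sub>m n - A))"
proof -
  define C where "C = map_mat complex_of_real A"
  have C: "C \<in> carrier_mat n n" using A by (simp add: C_def)
  obtain es where tr: "\<And>k. mat_trace (C ^\<^sub>m k) = (\<Sum>e\<leftarrow>es. e ^ k)"
    and dt: "det (1\<^sub>m n - C) = (\<Prod>e\<leftarrow>es. 1 - e)"
    and ev: "\<And>e. e \<in> set es \<Longrightarrow> eigenvalue C e"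
    using complex_trace_and_det_via_eigenvalues[OF C] by blast
  have lt: "cmod e < 1" if "e \<in> set es" for e
  proof -
    have "cmod e \<le> \<theta>"
      by (rule eigenvalue_norm_le[OF C v _ ev[OF that]]) (use bd A in \<open>auto simp: C_def\<close>)
    then show ?thesis using \<theta> by simp
  qed
  have trA: "mat_trace (C ^\<^sub>m k) = complex_of_real (mat_trace (A ^\<^sub>m k))" for k
  proof -
    have "C ^\<^sub>m k = map_mat complex_of_real (A ^\<^sub>m k)"
      unfolding C_def by (rule of_real_hom.mat_hom_pow[OF A, symmetric])
    then show ?thesis using A by (simp add: mat_trace_def)
  qed
  have "(\<lambda>k. \<Sum>e\<leftarrow>es. e ^ Suc k / of_nat (Suc k)) sums (\<Sum>e\<leftarrow>es. - Ln (1 - e))"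
    by (intro sums_sum_list neg_Ln_one_minus_sums lt)
  moreover have "(\<Sum>e\<leftarrow>es. e ^ Suc k / of_nat (Suc k))
      = complex_of_real (mat_trace (A ^\<^sub>m Suc k) / real (Suc k))" for k
    using trA[of "Suc k"] tr[of "Suc k"]
    by (simp add: divide_inverse sum_list_mult_const del: pow_mat.simps power_Suc)
  ultimately have s: "(\<lambda>k. complex_of_real (mat_trace (A ^\<^sub>m Suc k) / real (Suc k)))
      sums (\<Sum>e\<leftarrow>es. - Ln (1 - e))" by simp
  \<comment> \<open>The real parts converge to \<open>L\<close>; since all terms are real,
    uniqueness of limits makes the complex sum equal to \<open>L\<close> as well.\<close>
  define L where "L = Re (\<Sum>e\<leftarrow>es. - Ln (1 - e))"
  have "(\<lambda>k. mat_trace (A ^\<^sub>m Suc k) / real (Suc k)) sums L"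
    using sums_Re[OF s] by (simp add: L_def del: pow_mat.simps)
  moreover from this have "(\<Sum>e\<leftarrow>es. - Ln (1 - e)) = complex_of_real L"
    using s sums_of_real sums_unique2 by blast
  then have "complex_of_real (exp L) = inverse (det (1\<^sub>m n - C))"
    using exp_sum_list_neg_Ln[of es] lt dt by (simp add: exp_of_real)
  moreover have "det (1\<^sub>m n - C) = complex_of_real (det (1\<^sub>m n - A))"
  proof -
    have "1\<^sub>m n - C = map_mat complex_of_real (1\<^sub>m n - A)"
      using A by (intro eq_matI) (auto simp: C_def)
    then show ?thesis by (simp add: of_real_hom.hom_det)
  qed
  ultimately have "complex_of_real (exp L) = complex_of_real (inverse (det (1\<^sub>m n - A)))"
    by simp
  then have "exp L = inverse (det (1\<^sub>m n - A))" by (simp only: of_real_eq_iff)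
  with \<open>_ sums L\<close> show ?thesis by (rule that)
qed

section \<open>Traces as sums over cyclic words, and unconditional convergence\<close>

definition cyclic_weight :: "('a \<Rightarrow> 'a \<Rightarrow> 'b::monoid_mult) \<Rightarrow> 'a list \<Rightarrow> 'b" where
  "cyclic_weight M es = (\<Prod>(a, b)\<leftarrow>zip es (rotate1 es). M a b)"

lemma pow_mat_Suc_left:
  fixes A :: "'a::semiring_1 mat"
  assumes A: "A \<in> carrier_mat n n"
  shows "A ^\<^sub>m Suc k = A * A ^\<^sub>m k"
proof (induction k)
  case (Suc k)
  have "A ^\<^sub>m Suc (Suc k) = (A * A ^\<^sub>m k) * A" using Suc by simp
  also have "\<dots> = A * (A ^\<^sub>m k * A)" by (rule assoc_mult_mat[of _ n n _ n _ n]) (use A in auto)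
  finally show ?case by simp
qed (use A in simp)

lemma sum_lists_length_Suc:
  fixes f :: "'a list \<Rightarrow> 'b::comm_monoid_add"
  shows "(\<Sum>es | set es \<subseteq> S \<and> length es = Suc k. f es)
    = (\<Sum>a\<in>S. \<Sum>es | set es \<subseteq> S \<and> length es = k. f (a # es))"
proof -
  have "{es. set es \<subseteq> S \<and> length es = Suc k}
    = (\<lambda>(a, es). a # es) ` (S \<times> {es. set es \<subseteq> S \<and> length es = k})"
    by (auto simp: length_Suc_conv image_iff)
  moreover have "inj_on (\<lambda>(a, es). a # es) (S \<times> {es. set es \<subseteq> S \<and> length es = k})"
    by (auto intro: inj_onI)
  ultimately show ?thesis
    by (simp add: sum.reindex sum.cartesian_product case_prod_unfold)
qed

text \<open>\<open>es\<close> lists the \<open>k\<close> interior indices of a path with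
  \<open>k + 1\<close> steps. Setting \<open>j = i\<close> closes the path into the cyclic word
  \<open>i # es\<close>.\<close>

lemma pow_mat_path_sum:
  fixes A :: "'a::semiring_1 mat"
  assumes A: "A \<in> carrier_mat n n" and "i < n" "j < n"
  shows "(A ^\<^sub>m Suc k) $$ (i, j)
    = (\<Sum>es | set es \<subseteq> {..<n} \<and> length es = k. \<Prod>(a, b)\<leftarrow>zip (i # es) (es @ [j]). A $$ (a, b))"
  using assms(2)
proof (induction k arbitrary: i)
  case 0
  have "{es. set es \<subseteq> {..<n} \<and> length es = 0} = {[]}" by auto
  then show ?case using A 0 assms(3) by simp
next
  case (Suc k)
  have "(A ^\<^sub>m Suc (Suc k)) $$ (i, j) = (\<Sum>c<n. A $$ (i, c) * (A ^\<^sub>m Suc k) $$ (c, j))"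
    unfolding pow_mat_Suc_left[OF A, of "Suc k"]
    by (rule index_mult_mat_sum) (use A Suc.prems assms(3) in auto)
  also have "\<dots> = (\<Sum>c<n. \<Sum>es | set es \<subseteq> {..<n} \<and> length es = k.
      \<Prod>(a, b)\<leftarrow>zip (i # c # es) ((c # es) @ [j]). A $$ (a, b))"
    using Suc.IH by (simp add: sum_distrib_left del: pow_mat.simps)
  finally show ?case by (simp only: sum_lists_length_Suc)
qed

lemma mat_trace_pow_eq_cyclic_sum:
  fixes A :: "'a::semiring_1 mat"
  assumes A: "A \<in> carrier_mat n n"
  shows "mat_trace (A ^\<^sub>m Suc k)
    = (\<Sum>es | set es \<subseteq> {..<n} \<and> length es = Suc k. cyclic_weight (\<lambda>a b. A $$ (a, b)) es)"
proof -
  have "mat_trace (A ^\<^sub>m Suc k) = (\<Sum>i<n. (A ^\<^sub>m Suc k) $$ (i, i))"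
    using A by (simp add: mat_trace_def)
  also have "\<dots> = (\<Sum>i<n. \<Sum>es | set es \<subseteq> {..<n} \<and> length es = k.
      cyclic_weight (\<lambda>a b. A $$ (a, b)) (i # es))"
    by (intro sum.cong refl) (simp add: pow_mat_path_sum[OF A] cyclic_weight_def del: pow_mat.simps)
  finally show ?thesis by (simp only: sum_lists_length_Suc)
qed

text \<open>The weighted column bound iterates to \<open>\<theta> ^ k\<close>. A diagonal entry is
  one nonnegative term of its column sum, and its weight \<open>v j\<close> cancels against the
  right-hand side, so the bound does not depend on \<open>v\<close>.\<close>

lemma mat_trace_pow_le:
  fixes B :: "real mat" and v :: "nat \<Rightarrow> real"
  assumes B: "B \<in> carrier_mat n n" and nn: "\<And>i j. i < n \<Longrightarrow> j < n \<Longrightarrow> B $$ (i, j) \<ge> 0"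
    and v: "\<And>i. i < n \<Longrightarrow> v i > 0" and \<theta>: "\<theta> \<ge> 0"
    and bd: "\<And>j. j < n \<Longrightarrow> (\<Sum>i<n. v i * B $$ (i, j)) \<le> \<theta> * v j"
  shows "mat_trace (B ^\<^sub>m k) \<le> real n * \<theta> ^ k"
proof -
  have Bk: "B ^\<^sub>m k \<in> carrier_mat n n" for k using B by simp
  have nnk: "(B ^\<^sub>m k) $$ (i, j) \<ge> 0" if "i < n" "j < n" for i j k
    using that
  proof (induction k arbitrary: j)
    case (Suc k)
    then show ?case using index_mult_mat_sum[OF Bk B, of i j k] nn by (auto intro!: sum_nonneg)
  qed (use B in auto)
  have col: "(\<Sum>i<n. v i * (B ^\<^sub>m k) $$ (i, j)) \<le> \<theta> ^ k * v j" if "j < n" for j k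
    using that
  proof (induction k arbitrary: j)
    case 0
    have "(\<Sum>i<n. v i * (B ^\<^sub>m 0) $$ (i, j)) = (\<Sum>i<n. if i = j then v i else 0)"
      using B 0 by (intro sum.cong) auto
    then show ?case using 0 by (simp add: sum.delta)
  next
    case (Suc k)
    have "(\<Sum>i<n. v i * (B ^\<^sub>m Suc k) $$ (i, j))
        = (\<Sum>i<n. v i * (\<Sum>c<n. (B ^\<^sub>m k) $$ (i, c) * B $$ (c, j)))"
      using Suc.prems by (intro sum.cong refl) (simp add: index_mult_mat_sum[OF Bk B] del: index_mult_mat(1))
    also have "\<dots> = (\<Sum>c<n. (\<Sum>i<n. v i * (B ^\<^sub>m k) $$ (i, c)) * B $$ (c, j))"
      by (simp add: sum_distrib_left sum_distrib_right mult.assoc) (rule sum.swap)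
    also have "\<dots> \<le> (\<Sum>c<n. (\<theta> ^ k * v c) * B $$ (c, j))"
      using Suc nn by (intro sum_mono mult_right_mono) auto
    also have "\<dots> = \<theta> ^ k * (\<Sum>c<n. v c * B $$ (c, j))"
      by (simp add: sum_distrib_left mult.assoc)
    also have "\<dots> \<le> \<theta> ^ k * (\<theta> * v j)"
      using bd[OF Suc.prems] \<theta> by (intro mult_left_mono) auto
    finally show ?case by (simp add: mult_ac)
  qed
  have "(B ^\<^sub>m k) $$ (j, j) \<le> \<theta> ^ k" if j: "j < n" for j
  proof -
    have "v j * (B ^\<^sub>m k) $$ (j, j) \<le> (\<Sum>i<n. v i * (B ^\<^sub>m k) $$ (i, j))"
      by (rule member_le_sum) (use j v nnk in \<open>auto intro!: mult_nonneg_nonneg intro: less_imp_le\<close>)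
    also have "\<dots> \<le> \<theta> ^ k * v j" by (rule col[OF j])
    finally show ?thesis using v[OF j] by (simp add: mult.commute)
  qed
  then have "(\<Sum>j<n. (B ^\<^sub>m k) $$ (j, j)) \<le> (\<Sum>j<n. \<theta> ^ k)" by (intro sum_mono) auto
  then show ?thesis using B by (simp add: mat_trace_def)
qed

lemma prod_list_abs:
  fixes xs :: "'a::linordered_idom list"
  shows "\<bar>prod_list xs\<bar> = prod_list (map abs xs)"
  by (induction xs) (auto simp: abs_mult)

text \<open>Upgrades the series ordered by length to an unconditional sum over words. The words of
  length \<open>k + 1\<close> have total absolute weight at most the trace of the corresponding
  power of the entrywise absolute value, which decays geometrically.\<close>

lemma cyclic_weight_has_sum:
  fixes A :: "real mat" and v :: "nat \<Rightarrow> real"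
  assumes A: "A \<in> carrier_mat n n" and v: "\<And>i. i < n \<Longrightarrow> v i > 0"
    and bd: "\<And>j. j < n \<Longrightarrow> (\<Sum>i<n. v i * \<bar>A $$ (i, j)\<bar>) \<le> \<theta> * v j" and \<theta>: "0 \<le> \<theta>" "\<theta> < 1"
    and L: "(\<lambda>k. mat_trace (A ^\<^sub>m Suc k) / real (Suc k)) sums L"
  shows "((\<lambda>es. cyclic_weight (\<lambda>a b. A $$ (a, b)) es / real (length es)) has_sum L)
    {es. es \<noteq> [] \<and> set es \<subseteq> {..<n}}"
proof -
  define W where "W = (\<lambda>k. {es. set es \<subseteq> {..<n} \<and> length es = Suc k})"
  define f where "f = (\<lambda>es. cyclic_weight (\<lambda>a b. A $$ (a, b)) es / real (length es))"
  have fin: "finite (W k)" for k unfolding W_def by (rule finite_lists_length_eq) simp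
  define B where "B = map_mat abs A"
  have B: "B \<in> carrier_mat n n" using A by (simp add: B_def)
  have absw: "\<bar>cyclic_weight (\<lambda>a b. A $$ (a, b)) es\<bar> = cyclic_weight (\<lambda>a b. B $$ (a, b)) es"
    if "es \<in> W k" for es k
  proof -
    have "\<bar>A $$ (a, b)\<bar> = B $$ (a, b)" if ab: "(a, b) \<in> set (zip es (rotate1 es))" for a b
    proof -
      have "a < n" "b < n"
        using set_zip_leftD[OF ab] set_zip_rightD[OF ab] \<open>es \<in> W k\<close> by (auto simp: W_def)
      then show ?thesis using A by (simp add: B_def)
    qed
    then show ?thesis
      unfolding cyclic_weight_def prod_list_abs map_map by (intro arg_cong[of _ _ prod_list] map_cong) auto
  qed
  have wsum: "(\<Sum>es\<in>W k. \<bar>f es\<bar>) \<le> real n * \<theta> ^ Suc k" for k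
  proof -
    have "(\<Sum>es\<in>W k. \<bar>f es\<bar>) \<le> (\<Sum>es\<in>W k. cyclic_weight (\<lambda>a b. B $$ (a, b)) es)"
    proof (rule sum_mono)
      fix es assume es: "es \<in> W k"
      then have "real (length es) \<ge> 1" by (simp add: W_def)
      then have "\<bar>f es\<bar> \<le> \<bar>cyclic_weight (\<lambda>a b. A $$ (a, b)) es\<bar>"
        by (simp add: f_def abs_divide divide_le_eq mult_left_le mult_le_cancel_left1)
      then show "\<bar>f es\<bar> \<le> cyclic_weight (\<lambda>a b. B $$ (a, b)) es" using absw[OF es] by simp
    qed
    also have "\<dots> = mat_trace (B ^\<^sub>m Suc k)" unfolding W_def by (rule mat_trace_pow_eq_cyclic_sum[OF B, symmetric])
    also have "\<dots> \<le> real n * \<theta> ^ Suc k"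
    proof (rule mat_trace_pow_le[OF B _ v \<theta>(1)])
      fix j assume j: "j < n"
      have "(\<Sum>i<n. v i * B $$ (i, j)) = (\<Sum>i<n. v i * \<bar>A $$ (i, j)\<bar>)"
        using A j by (intro sum.cong) (auto simp: B_def)
      then show "(\<Sum>i<n. v i * B $$ (i, j)) \<le> \<theta> * v j" using bd[OF j] by simp
    qed (use A in \<open>auto simp: B_def\<close>)
    finally show ?thesis .
  qed
  have "(\<lambda>(k, es). f es) abs_summable_on (Sigma UNIV W)"
    unfolding abs_summable_on_Sigma_iff
  proof (intro conjI ballI)
    show "(\<lambda>es. (case (k, es) of (k, es) \<Rightarrow> f es)) abs_summable_on W k" for k
      using fin by (intro summable_on_finite) auto
    have s: "(\<lambda>k. real n * \<theta> ^ Suc k) abs_summable_on UNIV"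
    proof (rule norm_summable_imp_summable_on)
      show "summable (\<lambda>k. norm (norm (real n * \<theta> ^ Suc k)))"
        using \<theta> by (simp add: abs_mult power_abs summable_mult summable_geometric)
    qed
    show "(\<lambda>k. infsum (\<lambda>es. norm (case (k, es) of (k, es) \<Rightarrow> f es)) (W k)) abs_summable_on UNIV"
    proof (rule abs_summable_on_comparison_test[OF s])
      fix k
      show "norm (infsum (\<lambda>es. norm (case (k, es) of (k, es) \<Rightarrow> f es)) (W k)) \<le> norm (real n * \<theta> ^ Suc k)"
        using wsum[of k] fin[of k] by (simp add: sum_nonneg)
    qed
  qed
  then have "(\<lambda>(k, es). f es) summable_on (Sigma UNIV W)" by (rule abs_summable_summable)
  then obtain T where T: "((\<lambda>(k, es). f es) has_sum T) (Sigma UNIV W)"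
    by (auto simp: summable_on_def)
  have "((\<lambda>k. mat_trace (A ^\<^sub>m Suc k) / real (Suc k)) has_sum T) UNIV"
  proof (rule has_sum_Sigma'[OF T])
    fix k
    have "mat_trace (A ^\<^sub>m Suc k) / real (Suc k) = (\<Sum>es\<in>W k. f es)"
      unfolding mat_trace_pow_eq_cyclic_sum[OF A] sum_divide_distrib W_def[symmetric]
      by (intro sum.cong) (auto simp: f_def W_def)
    then show "((\<lambda>y. case (k, y) of (k, es) \<Rightarrow> f es) has_sum mat_trace (A ^\<^sub>m Suc k) / real (Suc k)) (W k)"
      using fin by (simp add: has_sum_finite del: pow_mat.simps)
  qed
  then have "T = L" using L has_sum_imp_sums sums_unique2 by blast
  \<comment> \<open>A word determines its length, so the grading by length can be forgotten.\<close>
  have bij: "bij_betw snd (Sigma UNIV W) {es. es \<noteq> [] \<and> set es \<subseteq> {..<n}}"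
    unfolding bij_betw_def
  proof (intro conjI)
    show "inj_on snd (Sigma UNIV W)" by (auto simp: inj_on_def W_def)
    show "snd ` Sigma UNIV W = {es. es \<noteq> [] \<and> set es \<subseteq> {..<n}}"
    proof (intro equalityI subsetI)
      fix es assume "es \<in> {es. es \<noteq> [] \<and> set es \<subseteq> {..<n}}"
      then have "(length es - 1, es) \<in> Sigma UNIV W" by (auto simp: W_def)
      then show "es \<in> snd ` Sigma UNIV W" by force
    qed (auto simp: W_def)
  qed
  have "((\<lambda>x. f (snd x)) has_sum L) (Sigma UNIV W)"
    using T \<open>T = L\<close> by (simp add: case_prod_unfold)
  then have "(f has_sum L) {es. es \<noteq> [] \<and> set es \<subseteq> {..<n}}"
    using has_sum_reindex_bij_betw[OF bij, of f L] by simp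
  then show ?thesis unfolding f_def .
qed

section \<open>Determinant of the non-backtracking matrix\<close>

text \<open>Sylvester's identity. The two products of \<open>?B\<close> and \<open>?T\<close> are
  block upper triangular with the two sides on their diagonals, and they have equal
  determinants.\<close>

lemma det_one_minus_mult_commute:
  fixes X Y :: "'a::idom mat"
  assumes X: "X \<in> carrier_mat n m" and Y: "Y \<in> carrier_mat m n"
  shows "det (1\<^sub>m n - X * Y) = det (1\<^sub>m m - Y * X)"
proof -
  let ?B = "four_block_mat (1\<^sub>m n) X Y (1\<^sub>m m)"
  let ?T = "four_block_mat (1\<^sub>m n) (0\<^sub>m n m) (- Y) (1\<^sub>m m)"
  have B: "?B \<in> carrier_mat (n + m) (n + m)" and T: "?T \<in> carrier_mat (n + m) (n + m)"
    using X Y by auto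
  have mY: "- Y \<in> carrier_mat m n" using Y by simp
  have "?B * ?T = four_block_mat (1\<^sub>m n * 1\<^sub>m n + X * (- Y)) (1\<^sub>m n * 0\<^sub>m n m + X * 1\<^sub>m m)
      (Y * 1\<^sub>m n + 1\<^sub>m m * (- Y)) (Y * 0\<^sub>m n m + 1\<^sub>m m * 1\<^sub>m m)"
    by (rule mult_four_block_mat[OF _ X Y _ _ _ mY]) auto
  also have "\<dots> = four_block_mat (1\<^sub>m n - X * Y) X (0\<^sub>m m n) (1\<^sub>m m)"
    using X Y by (intro cong_four_block_mat) (auto intro!: eq_matI)
  also have "det \<dots> = det (1\<^sub>m n - X * Y) * det (1\<^sub>m m)"
    by (rule det_four_block_mat_lower_left_zero) (use X Y in auto)
  finally have 1: "det (?B * ?T) = det (1\<^sub>m n - X * Y)" by simp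
  have "?T * ?B = four_block_mat (1\<^sub>m n * 1\<^sub>m n + 0\<^sub>m n m * Y) (1\<^sub>m n * X + 0\<^sub>m n m * 1\<^sub>m m)
      (- Y * 1\<^sub>m n + 1\<^sub>m m * Y) (- Y * X + 1\<^sub>m m * 1\<^sub>m m)"
    by (rule mult_four_block_mat[OF _ _ mY _ _ X Y]) auto
  also have "\<dots> = four_block_mat (1\<^sub>m n) X (0\<^sub>m m n) (1\<^sub>m m - Y * X)"
    using X Y by (intro cong_four_block_mat) (auto intro!: eq_matI)
  also have "det \<dots> = det (1\<^sub>m n) * det (1\<^sub>m m - Y * X)"
    by (rule det_four_block_mat_lower_left_zero) (use X Y in auto)
  finally have 2: "det (?T * ?B) = det (1\<^sub>m m - Y * X)" by simp
  show ?thesis using 1 2 det_mult[OF B T] det_mult[OF T B] by (simp add: mult.commute)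
qed

text \<open>Index \<open>s + m\<close> is the reversal of index \<open>s\<close>, so weighted edge
  reversal becomes a pair of diagonal off-diagonal blocks.\<close>

definition edge_enum :: "nat \<Rightarrow> (nat \<Rightarrow> nat \<times> nat) \<Rightarrow> nat \<Rightarrow> nat \<times> nat" where
  "edge_enum m b s = (if s < m then b s else prod.swap (b (s - m)))"

text \<open>An entry of the weighted Hashimoto edge matrix. The weight sits on the edge being
  entered, so around a cyclic word each step is counted exactly once.\<close>

definition nb_entry :: "(nat \<times> nat \<Rightarrow> 'a::zero) \<Rightarrow> nat \<times> nat \<Rightarrow> nat \<times> nat \<Rightarrow> 'a" where
  "nb_entry u e f = (if snd e = fst f \<and> f \<noteq> (snd e, fst e) then u f else 0)"

lemma det_four_block_diag:
  fixes p q :: "nat \<Rightarrow> 'a::idom"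
  shows "det (four_block_mat (1\<^sub>m m) (mat m m (\<lambda>(s, t). if s = t then p s else 0))
    (mat m m (\<lambda>(s, t). if s = t then q s else 0)) (1\<^sub>m m)) = (\<Prod>s<m. 1 - p s * q s)"
proof -
  let ?P = "mat m m (\<lambda>(s, t). if s = t then p s else 0)"
  let ?Q = "mat m m (\<lambda>(s, t). if s = t then q s else 0)"
  have PQ: "?P * ?Q = mat m m (\<lambda>(s, t). if s = t then p s * q s else 0)"
  proof (rule eq_matI)
    fix s t assume st: "s < dim_row (mat m m (\<lambda>(s, t). if s = t then p s * q s else 0))"
      "t < dim_col (mat m m (\<lambda>(s, t). if s = t then p s * q s else 0))"
    then have "(?P * ?Q) $$ (s, t) = (\<Sum>c<m. ?P $$ (s, c) * ?Q $$ (c, t))"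
      by (intro index_mult_mat_sum[of _ m m _ m]) auto
    also have "\<dots> = (\<Sum>c<m. if c = s then (if s = t then p s * q s else 0) else 0)"
      using st by (intro sum.cong) auto
    finally show "(?P * ?Q) $$ (s, t) = mat m m (\<lambda>(s, t). if s = t then p s * q s else 0) $$ (s, t)"
      using st by (simp add: sum.delta)
  qed auto
  have "det (four_block_mat (1\<^sub>m m) ?P ?Q (1\<^sub>m m)) = det (1\<^sub>m m * 1\<^sub>m m - ?P * ?Q)"
    by (rule det_four_block_mat) auto
  also have "\<dots> = det (mat m m (\<lambda>(s, t). if s = t then 1 - p s * q s else 0))"
    unfolding PQ by (intro arg_cong[of _ _ det] eq_matI) auto
  also have "\<dots> = prod_list (diag_mat (mat m m (\<lambda>(s, t). if s = t then 1 - p s * q s else 0)))"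
    by (intro det_upper_triangular[of _ m]) auto
  also have "\<dots> = (\<Prod>s<m. 1 - p s * q s)"
    by (simp add: prod_list_diag_prod lessThan_atLeast0)
  finally show ?thesis .
qed

text \<open>
  The matrix is \<open>K - P Y\<close> with \<open>K = I +\<close> (weighted edge reversal) and \<open>P Y\<close> the weighted adjacency of
  directed edges, of rank at most \<open>n\<close>. Writing \<open>P = K X\<close> gives \<open>K (I - X Y)\<close>, and
  \<open>det (I - X Y) = det (I - Y X)\<close>.
\<close>

lemma det_nb_matrix:
  fixes u :: "nat \<times> nat \<Rightarrow> 'a::field" and b :: "nat \<Rightarrow> nat \<times> nat" and m n :: nat
  defines "\<epsilon> \<equiv> edge_enum m b"
  assumes lt: "\<And>s. s < 2 * m \<Longrightarrow> fst (\<epsilon> s) < n \<and> snd (\<epsilon> s) < n"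
    and inj: "inj_on \<epsilon> {..<2 * m}"
    and nz: "\<And>s. s < 2 * m \<Longrightarrow> 1 - u (\<epsilon> s) * u (prod.swap (\<epsilon> s)) \<noteq> 0"
  shows "det (1\<^sub>m (2 * m) - mat (2 * m) (2 * m) (\<lambda>(s, t). nb_entry u (\<epsilon> s) (\<epsilon> t)))
    = (\<Prod>s<m. 1 - u (b s) * u (prod.swap (b s)))
      * det (mat n n (\<lambda>(i, j). (if i = j then 1 else 0)
          - (\<Sum>s<2 * m. (if fst (\<epsilon> s) = i then u (\<epsilon> s) else 0)
              * ((if snd (\<epsilon> s) = j then 1 else 0) - (if fst (\<epsilon> s) = j then u (prod.swap (\<epsilon> s)) else 0))
              / (1 - u (\<epsilon> s) * u (prod.swap (\<epsilon> s))))))"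
proof -
  define N where "N = 2 * m"
  \<comment> \<open>\<open>\<sigma> s\<close> is the index of the reversed edge.\<close>
  define \<sigma> where "\<sigma> = (\<lambda>s. if s < m then s + m else s - m)"
  define w where "w = (\<lambda>s. 1 - u (\<epsilon> s) * u (prod.swap (\<epsilon> s)))"
  have \<sigma>: "\<sigma> s < N" "\<epsilon> (\<sigma> s) = prod.swap (\<epsilon> s)" "\<sigma> s \<noteq> s" if "s < N" for s
    using that by (auto simp: \<sigma>_def \<epsilon>_def edge_enum_def N_def)
  have swap_iff: "\<epsilon> t = prod.swap (\<epsilon> s) \<longleftrightarrow> t = \<sigma> s" if "s < N" "t < N" for s t
    using inj_onD[OF inj, of t "\<sigma> s"] \<sigma>[of s] that by (auto simp: N_def)
  define K where "K = mat N N (\<lambda>(s, t). (if s = t then 1 else 0) + (if t = \<sigma> s then u (\<epsilon> t) else 0))"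
  define P where "P = mat N n (\<lambda>(s, j). if snd (\<epsilon> s) = j then 1 else (0::'a))"
  define Y where "Y = mat n N (\<lambda>(i, s). if fst (\<epsilon> s) = i then u (\<epsilon> s) else 0)"
  \<comment> \<open>On an edge and its reversal, \<open>K\<close> acts as a 2 by 2 block with unit
    diagonal and determinant \<open>w s\<close>. Applying the inverse block to \<open>P\<close>
    gives this formula.\<close>
  define X where "X = mat N n (\<lambda>(s, j). ((if snd (\<epsilon> s) = j then 1 else 0)
      - (if fst (\<epsilon> s) = j then u (prod.swap (\<epsilon> s)) else 0)) / w s)"
  define M where "M = mat N N (\<lambda>(s, t). nb_entry u (\<epsilon> s) (\<epsilon> t))"
  have car: "K \<in> carrier_mat N N" "P \<in> carrier_mat N n" "Y \<in> carrier_mat n N" "X \<in> carrier_mat N n"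
    "M \<in> carrier_mat N N"
    by (simp_all add: K_def P_def Y_def X_def M_def)
  have KX: "K * X = P"
  proof (rule eq_matI)
    fix s j assume "s < dim_row P" "j < dim_col P"
    then have s: "s < N" and j: "j < n" by (simp_all add: P_def)
    have ws: "w s \<noteq> 0" using nz s by (simp add: w_def N_def)
    have "w (\<sigma> s) = w s" using \<sigma>[OF s] by (simp add: w_def mult.commute)
    have "(K * X) $$ (s, j) = (\<Sum>t<N. K $$ (s, t) * X $$ (t, j))"
      by (rule index_mult_mat_sum[OF car(1,4) s j])
    also have "\<dots> = (\<Sum>t<N. (if t = s then X $$ (s, j) else 0) + (if t = \<sigma> s then u (\<epsilon> (\<sigma> s)) * X $$ (\<sigma> s, j) else 0))"
      using s \<sigma>[OF s] by (intro sum.cong) (auto simp: K_def)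
    also have "\<dots> = X $$ (s, j) + u (\<epsilon> (\<sigma> s)) * X $$ (\<sigma> s, j)"
      using s \<sigma>[OF s] by (simp add: sum.distrib sum.delta)
    also have "\<dots> = (if snd (\<epsilon> s) = j then 1 else 0)"
    proof -
      define a c where "a = (if snd (\<epsilon> s) = j then 1 else (0::'a))"
        and "c = (if fst (\<epsilon> s) = j then 1 else (0::'a))"
      have "X $$ (s, j) = (a - c * u (prod.swap (\<epsilon> s))) / w s"
        using s j by (simp add: X_def a_def c_def)
      moreover have "X $$ (\<sigma> s, j) = (c - a * u (\<epsilon> s)) / w s"
        using \<sigma>[OF s] j \<open>w (\<sigma> s) = w s\<close> by (simp add: X_def a_def c_def)
      ultimately have "X $$ (s, j) + u (\<epsilon> (\<sigma> s)) * X $$ (\<sigma> s, j)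
        = (a - c * u (prod.swap (\<epsilon> s)) + u (prod.swap (\<epsilon> s)) * (c - a * u (\<epsilon> s))) / w s"
        using \<sigma>(2)[OF s] by (simp add: add_divide_distrib)
      also have "a - c * u (prod.swap (\<epsilon> s)) + u (prod.swap (\<epsilon> s)) * (c - a * u (\<epsilon> s)) = a * w s"
        by (simp add: w_def algebra_simps)
      finally show ?thesis using ws by (simp add: a_def)
    qed
    finally show "(K * X) $$ (s, j) = P $$ (s, j)" using s j by (simp add: P_def)
  qed (simp_all add: K_def X_def P_def)
  \<comment> \<open>\<open>P * Y\<close> admits every continuation of an edge, including its
    reversal; the second summand of \<open>K\<close> removes the reversals that \<open>M\<close>
    forbids.\<close>
  have PY: "1\<^sub>m N - M = K - P * Y"
  proof (rule eq_matI)
    fix s t assume "s < dim_row (K - P * Y)" "t < dim_col (K - P * Y)"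
    then have s: "s < N" and t: "t < N" by (simp_all add: P_def Y_def)
    have "(P * Y) $$ (s, t) = (\<Sum>i<n. P $$ (s, i) * Y $$ (i, t))"
      by (rule index_mult_mat_sum[OF car(2,3) s t])
    also have "\<dots> = (\<Sum>i<n. if i = snd (\<epsilon> s) then (if snd (\<epsilon> s) = fst (\<epsilon> t) then u (\<epsilon> t) else 0) else 0)"
      using s t by (intro sum.cong) (auto simp: P_def Y_def)
    also have "\<dots> = (if snd (\<epsilon> s) = fst (\<epsilon> t) then u (\<epsilon> t) else 0)"
      using lt[of s] s by (simp add: sum.delta N_def)
    finally have py: "(P * Y) $$ (s, t) = (if snd (\<epsilon> s) = fst (\<epsilon> t) then u (\<epsilon> t) else 0)" .
    have "(K - P * Y) $$ (s, t) = K $$ (s, t) - (P * Y) $$ (s, t)"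
      using s t car by (intro index_minus_mat) auto
    moreover have "(1\<^sub>m N - M) $$ (s, t) = (if s = t then 1 else 0) - nb_entry u (\<epsilon> s) (\<epsilon> t)"
      using s t car by (simp add: M_def)
    moreover have "\<epsilon> t = (snd (\<epsilon> s), fst (\<epsilon> s)) \<longleftrightarrow> t = \<sigma> s"
      using swap_iff[OF s t] by (simp add: prod.swap_def)
    moreover have "snd (\<epsilon> s) = fst (\<epsilon> t)" if "t = \<sigma> s" using \<sigma>(2)[OF s] that by simp
    ultimately show "(1\<^sub>m N - M) $$ (s, t) = (K - P * Y) $$ (s, t)"
      unfolding py using s t by (auto simp: K_def nb_entry_def)
  qed (simp_all add: K_def M_def P_def Y_def)
  also have "K - P * Y = K * (1\<^sub>m N - X * Y)"
  proof -
    have "K * (1\<^sub>m N - X * Y) = K * 1\<^sub>m N - K * (X * Y)"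
      by (rule mult_minus_distrib_mat[of _ N N _ N]) (use car in auto)
    also have "K * (X * Y) = K * X * Y" by (rule assoc_mult_mat[symmetric, OF car(1,4,3)])
    finally show ?thesis using car by (simp add: KX)
  qed
  finally have "det (1\<^sub>m N - M) = det K * det (1\<^sub>m N - X * Y)"
    using det_mult[OF car(1), of "1\<^sub>m N - X * Y"] car by (metis minus_carrier_mat mult_carrier_mat)
  also have "det (1\<^sub>m N - X * Y) = det (1\<^sub>m n - Y * X)"
    by (rule det_one_minus_mult_commute[OF car(4,3)])
  also have "det K = (\<Prod>s<m. 1 - u (b s) * u (prod.swap (b s)))"
  proof -
    have "K = four_block_mat (1\<^sub>m m) (mat m m (\<lambda>(s, t). if s = t then u (prod.swap (b s)) else 0))
      (mat m m (\<lambda>(s, t). if s = t then u (b s) else 0)) (1\<^sub>m m)"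
      by (rule eq_matI) (auto simp: K_def N_def \<sigma>_def \<epsilon>_def edge_enum_def)
    then show ?thesis by (simp add: det_four_block_diag mult.commute)
  qed
  also have "1\<^sub>m n - Y * X = mat n n (\<lambda>(i, j). (if i = j then 1 else 0)
          - (\<Sum>s<2 * m. (if fst (\<epsilon> s) = i then u (\<epsilon> s) else 0)
              * ((if snd (\<epsilon> s) = j then 1 else 0) - (if fst (\<epsilon> s) = j then u (prod.swap (\<epsilon> s)) else 0))
              / (1 - u (\<epsilon> s) * u (prod.swap (\<epsilon> s)))))" (is "_ = ?F")
  proof (rule eq_matI)
    fix i j assume "i < dim_row ?F" "j < dim_col ?F"
    then have i: "i < n" and j: "j < n" by simp_all
    have "(Y * X) $$ (i, j) = (\<Sum>s<N. Y $$ (i, s) * X $$ (s, j))"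
      by (rule index_mult_mat_sum[OF car(3,4) i j])
    also have "\<dots> = (\<Sum>s<2 * m. (if fst (\<epsilon> s) = i then u (\<epsilon> s) else 0)
              * ((if snd (\<epsilon> s) = j then 1 else 0) - (if fst (\<epsilon> s) = j then u (prod.swap (\<epsilon> s)) else 0))
              / (1 - u (\<epsilon> s) * u (prod.swap (\<epsilon> s))))"
      using i j by (intro sum.cong) (auto simp: Y_def X_def N_def w_def)
    finally have "(Y * X) $$ (i, j) = \<dots>" .
    moreover have "(1\<^sub>m n - Y * X) $$ (i, j) = (if i = j then 1 else 0) - (Y * X) $$ (i, j)"
      using i j car by (subst index_minus_mat) auto
    ultimately show "(1\<^sub>m n - Y * X) $$ (i, j) = ?F $$ (i, j)" using i j by simp
  qed (use car in simp_all)
  finally show ?thesis unfolding M_def N_def .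
qed

section \<open>The Neumann series and convergence of the messages\<close>

lemma pow_smult_mat_index:
  fixes A :: "'a::comm_semiring_1 mat"
  assumes A: "A \<in> carrier_mat n n" and "i < n" "j < n"
  shows "((c \<cdot>\<^sub>m A) ^\<^sub>m k) $$ (i, j) = c ^ k * (A ^\<^sub>m k) $$ (i, j)"
  using assms(3)
proof (induction k arbitrary: j)
  case 0
  then show ?case using A assms(2) by simp
next
  case (Suc k)
  have cA: "c \<cdot>\<^sub>m A \<in> carrier_mat n n" using A by simp
  have "((c \<cdot>\<^sub>m A) ^\<^sub>m Suc k) $$ (i, j) = (\<Sum>l<n. ((c \<cdot>\<^sub>m A) ^\<^sub>m k) $$ (i, l) * (c \<cdot>\<^sub>m A) $$ (l, j))"
    using index_mult_mat_sum[OF pow_carrier_mat[OF cA] cA assms(2) Suc.prems] by simp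
  also have "\<dots> = (\<Sum>l<n. c ^ Suc k * ((A ^\<^sub>m k) $$ (i, l) * A $$ (l, j)))"
    using A Suc by (intro sum.cong) (auto simp: mult_ac)
  also have "\<dots> = c ^ Suc k * (A ^\<^sub>m Suc k) $$ (i, j)"
    using index_mult_mat_sum[OF pow_carrier_mat[OF A] A assms(2) Suc.prems, of k]
    by (simp add: sum_distrib_left)
  finally show ?case .
qed

text \<open>Choosing \<open>s\<close> strictly between the spectral radius and 1 leaves
  \<open>C / s\<close> with spectral radius below 1, hence with bounded powers; undoing the scaling
  turns boundedness into geometric decay.\<close>

lemma pow_mat_geometric_bound:
  fixes C :: "complex mat"
  assumes C: "C \<in> carrier_mat n n" and sr: "spectral_radius C < 1"
  obtains c s where "0 < s" "s < 1" "\<And>k i j. i < n \<Longrightarrow> j < n \<Longrightarrow> cmod ((C ^\<^sub>m k) $$ (i, j)) \<le> c * s ^ k"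
\<comment> \<open>In dimension 0 the spectrum is empty, so the spectral radius cannot be attained by
  an eigenvalue.\<close>
proof (cases "n = 0")
  case True
  then show ?thesis using that[of "1/2" 0] by auto
next
  case False
  then have n: "n > 0" by simp
  define \<rho> where "\<rho> = spectral_radius C"
  have "\<rho> \<in> norm ` spectrum C" unfolding \<rho>_def by (rule spectral_radius_mem_max(1)[OF C n])
  then have "\<rho> \<ge> 0" by auto
  define s where "s = (\<rho> + 1) / 2"
  have s: "\<rho> < s" "0 < s" "s < 1" using \<open>\<rho> \<ge> 0\<close> sr by (auto simp: s_def \<rho>_def)
  define c where "c = complex_of_real (1 / s)"
  define C' where "C' = c \<cdot>\<^sub>m C"
  have C': "C' \<in> carrier_mat n n" using C by (simp add: C'_def)
  have "spectral_radius C' \<in> norm ` spectrum C'" by (rule spectral_radius_mem_max(1)[OF C' n])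
  then obtain e where e: "eigenvalue C' e" "spectral_radius C' = cmod e"
    by (auto simp: spectrum_def)
  obtain z where z: "z \<in> carrier_vec n" "z \<noteq> 0\<^sub>v n" "C' *\<^sub>v z = e \<cdot>\<^sub>v z"
    using e(1) C' by (auto simp: eigenvalue_def eigenvector_def)
  have sc: "complex_of_real s * c = 1" using s by (simp add: c_def)
  \<comment> \<open>An eigenvalue \<open>e\<close> of the scaled matrix is an eigenvalue
    \<open>s * e\<close> of \<open>C\<close>, which bounds the scaled spectral radius by
    \<open>\<rho> / s\<close>.\<close>
  have "C *\<^sub>v z = (complex_of_real s * e) \<cdot>\<^sub>v z"
  proof (rule eq_vecI)
    fix i assume "i < dim_vec ((complex_of_real s * e) \<cdot>\<^sub>v z)"
    then have i: "i < n" using z(1) by simp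
    have "c * vec_index (C *\<^sub>v z) i = vec_index (C' *\<^sub>v z) i"
      using i C z(1) by (simp add: C'_def scalar_prod_def sum_distrib_left mult.assoc)
    also have "\<dots> = e * vec_index z i" using z(1,3) i by simp
    finally have "complex_of_real s * c * vec_index (C *\<^sub>v z) i = complex_of_real s * (e * vec_index z i)"
      by (simp add: mult.assoc)
    then show "vec_index (C *\<^sub>v z) i = vec_index ((complex_of_real s * e) \<cdot>\<^sub>v z) i"
      using sc i z(1) by (simp add: mult.assoc)
  qed (use C z in auto)
  then have "eigenvalue C (complex_of_real s * e)"
    using z C by (auto simp: eigenvalue_def eigenvector_def)
  then have "cmod (complex_of_real s * e) \<le> \<rho>"
    unfolding \<rho>_def by (intro spectral_radius_mem_max(2)[OF C n]) (auto simp: spectrum_def)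
  then have "s * cmod e \<le> \<rho>" using s by (simp add: norm_mult)
  then have "s * cmod e < s" using s by linarith
  then have "spectral_radius C' < 1" using s e(2) by simp
  then obtain b where b: "\<And>k. norm_bound (C' ^\<^sub>m k) b"
    using spectral_radius_jnf_norm_bound_less_1_upper_triangular[OF C'] by blast
  have "cmod ((C ^\<^sub>m k) $$ (i, j)) \<le> b * s ^ k" if ij: "i < n" "j < n" for k i j
  proof -
    have "cmod ((C' ^\<^sub>m k) $$ (i, j)) \<le> b" using b[of k] C' ij by (simp add: norm_bound_def)
    moreover have "(C' ^\<^sub>m k) $$ (i, j) = c ^ k * (C ^\<^sub>m k) $$ (i, j)"
      unfolding C'_def by (rule pow_smult_mat_index[OF C ij])
    moreover have "cmod (c ^ k) = 1 / s ^ k" using s by (simp add: c_def norm_power norm_divide power_divide)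
    ultimately have "cmod ((C ^\<^sub>m k) $$ (i, j)) / s ^ k \<le> b" by (simp add: norm_mult)
    then show ?thesis using s by (simp add: divide_le_eq)
  qed
  then show ?thesis using that[of s b] s by blast
qed

lemma strictly_superharmonic_exists:
  fixes R :: "real mat"
  assumes R: "R \<in> carrier_mat n n"
    and sr: "spectral_radius (map_mat (\<lambda>x. complex_of_real \<bar>x\<bar>) R) < 1"
  obtains x where "\<And>i. i < n \<Longrightarrow> x i > 0"
    and "\<And>i. i < n \<Longrightarrow> (\<Sum>k<n. \<bar>R $$ (i, k)\<bar> * x k) = x i - 1"
proof -
  define B where "B = map_mat abs R"
  have B: "B \<in> carrier_mat n n" using R by (simp add: B_def)
  define C where "C = map_mat complex_of_real B"
  have C: "C \<in> carrier_mat n n" using B by (simp add: C_def)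
  have "map_mat (\<lambda>x. complex_of_real \<bar>x\<bar>) R = C" by (rule eq_matI) (auto simp: C_def B_def)
  then have "spectral_radius C < 1" using sr by simp
  then obtain c s where s: "0 < s" "s < 1"
    and bd: "\<And>k i j. i < n \<Longrightarrow> j < n \<Longrightarrow> cmod ((C ^\<^sub>m k) $$ (i, j)) \<le> c * s ^ k"
    using pow_mat_geometric_bound[OF C] by metis
  \<comment> \<open>\<open>g i k\<close> is the i-th entry of \<open>|R|^k\<close> applied to the
    all-ones vector. The term at 0 will give positivity of the sum, and an index shift its linear
    equation.\<close>
  define g where "g = (\<lambda>i k. \<Sum>j<n. (B ^\<^sub>m k) $$ (i, j))"
  have B_bd: "\<bar>(B ^\<^sub>m k) $$ (i, j)\<bar> \<le> c * s ^ k" if ij: "i < n" "j < n" for i j k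
  proof -
    have "C ^\<^sub>m k = map_mat complex_of_real (B ^\<^sub>m k)"
      unfolding C_def by (rule of_real_hom.mat_hom_pow[OF B, symmetric])
    then have "cmod ((C ^\<^sub>m k) $$ (i, j)) = \<bar>(B ^\<^sub>m k) $$ (i, j)\<bar>" using B ij by simp
    then show ?thesis using bd[OF ij, of k] by simp
  qed
  have summ: "summable (g i)" if i: "i < n" for i
    unfolding g_def
  proof (rule summable_sum)
    fix j assume "j \<in> {..<n}"
    then have j: "j < n" by simp
    show "summable (\<lambda>k. (B ^\<^sub>m k) $$ (i, j))"
    proof (rule summable_comparison_test')
      show "summable (\<lambda>k. c * s ^ k)" using s by (intro summable_mult summable_geometric) simp
      show "norm ((B ^\<^sub>m k) $$ (i, j)) \<le> c * s ^ k" for k using B_bd[OF i j] by simp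
    qed
  qed
  have g0: "g i 0 = 1" if i: "i < n" for i
  proof -
    have "g i 0 = (\<Sum>j<n. if j = i then 1 else 0)"
      unfolding g_def using B i by (intro sum.cong) auto
    then show ?thesis using i by (simp add: sum.delta)
  qed
  have gSuc: "g i (Suc k) = (\<Sum>l<n. \<bar>R $$ (i, l)\<bar> * g l k)" if i: "i < n" for i k
  proof -
    have "g i (Suc k) = (\<Sum>j<n. \<Sum>l<n. B $$ (i, l) * (B ^\<^sub>m k) $$ (l, j))"
      unfolding g_def pow_mat_Suc_left[OF B]
      using index_mult_mat_sum[OF B pow_carrier_mat[OF B] i] by (intro sum.cong) auto
    also have "\<dots> = (\<Sum>l<n. \<Sum>j<n. B $$ (i, l) * (B ^\<^sub>m k) $$ (l, j))" by (rule sum.swap)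
    also have "\<dots> = (\<Sum>l<n. \<bar>R $$ (i, l)\<bar> * g l k)"
      using R i by (intro sum.cong) (auto simp: g_def B_def sum_distrib_left)
    finally show ?thesis .
  qed
  have nonneg: "g i k \<ge> 0" if "i < n" for i k
    using that
  proof (induction k arbitrary: i)
    case (Suc k)
    then show ?case unfolding gSuc[OF Suc.prems] by (intro sum_nonneg mult_nonneg_nonneg) auto
  qed (simp add: g0)
  define x where "x = (\<lambda>i. \<Sum>k. g i k)"
  have eq: "(\<Sum>l<n. \<bar>R $$ (i, l)\<bar> * x l) = x i - 1" if i: "i < n" for i
  proof -
    have "(\<lambda>k. \<Sum>l<n. \<bar>R $$ (i, l)\<bar> * g l k) sums (\<Sum>l<n. \<bar>R $$ (i, l)\<bar> * x l)"
      unfolding x_def using summ by (intro sums_sum sums_mult summable_sums) auto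
    then have "(\<lambda>k. g i (Suc k)) sums (\<Sum>l<n. \<bar>R $$ (i, l)\<bar> * x l)" by (simp add: gSuc[OF i])
    moreover have "(\<lambda>k. g i (Suc k)) sums (x i - g i 0)"
      using summable_sums[OF summ[OF i]] unfolding x_def sums_Suc_iff by simp
    ultimately show ?thesis using sums_unique2 g0[OF i] by metis
  qed
  have "x i > 0" if i: "i < n" for i
    unfolding x_def by (rule suminf_pos2[OF summ[OF i], of 0]) (use nonneg[OF i] g0[OF i] in auto)
  then show ?thesis using that eq by blast
qed

lemma det_two_by_two:
  fixes A :: "'a::comm_ring_1 mat"
  assumes "A \<in> carrier_mat 2 2"
  shows "det A = A $$ (0, 0) * A $$ (1, 1) - A $$ (0, 1) * A $$ (1, 0)"
proof -
  have d1: "det B = B $$ (0, 0)" if "B \<in> carrier_mat 1 1" for B :: "'a mat"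
    using that by (simp add: det_single)
  have "det A = (\<Sum>j<2. A $$ (0, j) * cofactor A 0 j)"
    by (rule laplace_expansion_row[OF assms]) simp
  also have "\<dots> = A $$ (0, 0) * A $$ (1, 1) - A $$ (0, 1) * A $$ (1, 0)"
    using assms mat_delete_carrier[of A 2 2 0 0] mat_delete_carrier[of A 2 2 0 1]
    by (simp add: cofactor_def d1 mat_delete_def numeral_2_eq_2)
  finally show ?thesis .
qed

text \<open>The spectral hypothesis on |R| is used only to produce \<open>x\<close>. From here on
  the estimates rest on the linear identity \<open>x_eq\<close>.\<close>

locale strictly_superharmonic =
  fixes R :: "real mat" and n :: nat and x :: "nat \<Rightarrow> real"
  assumes carrier: "R \<in> carrier_mat n n"
    and sym: "\<And>i j. i < n \<Longrightarrow> j < n \<Longrightarrow> R $$ (i, j) = R $$ (j, i)"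
    and diag: "\<And>i. i < n \<Longrightarrow> R $$ (i, i) = 0"
    and x_pos: "\<And>i. i < n \<Longrightarrow> x i > 0"
    and x_eq: "\<And>i. i < n \<Longrightarrow> (\<Sum>k<n. \<bar>R $$ (i, k)\<bar> * x k) = x i - 1"
begin

lemma dim_R [simp]: "dim_row R = n" "dim_col R = n"
  using carrier by auto

lemma nbrs_eq: "nbrs R i = {k. k < n \<and> R $$ (i, k) \<noteq> 0}"
  by (simp add: nbrs_def)

lemma finite_nbrs [simp]: "finite (nbrs R i)"
  by (simp add: nbrs_eq)

lemma dir_edges_iff: "(i, j) \<in> dir_edges R \<longleftrightarrow> i < n \<and> j \<in> nbrs R i"
  by (auto simp: dir_edges_def nbrs_eq)

lemma dir_edges_swap: "(i, j) \<in> dir_edges R \<Longrightarrow> (j, i) \<in> dir_edges R"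
  using sym by (auto simp: dir_edges_def)

lemma sum_nbrs_x:
  assumes "i < n"
  shows "(\<Sum>k\<in>nbrs R i. \<bar>R $$ (i, k)\<bar> * x k) = x i - 1"
proof -
  have "(\<Sum>k\<in>nbrs R i. \<bar>R $$ (i, k)\<bar> * x k) = (\<Sum>k<n. \<bar>R $$ (i, k)\<bar> * x k)"
    by (rule sum.mono_neutral_left) (auto simp: nbrs_eq)
  then show ?thesis using x_eq[OF assms] by simp
qed

lemma sum_nbrs_excl_x:
  assumes "i < n" "j < n"
  shows "(\<Sum>k\<in>nbrs R i - {j}. \<bar>R $$ (i, k)\<bar> * x k) = x i - 1 - \<bar>R $$ (i, j)\<bar> * x j"
proof (cases "j \<in> nbrs R i")
  case True
  then show ?thesis using sum_nbrs_x[OF assms(1)] by (simp add: sum.remove[of "nbrs R i" j])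
next
  case False
  then have "R $$ (i, j) = 0" using assms by (simp add: nbrs_eq)
  then show ?thesis using sum_nbrs_x[OF assms(1)] False by simp
qed

lemma lower_bound_pos:
  assumes "i < n" "j < n"
  shows "(1 + \<bar>R $$ (i, j)\<bar> * x j) / x i > 0"
  using x_pos[OF assms(1)] x_pos[OF assms(2)] by (simp add: add_pos_nonneg)

text \<open>Summing the assumed bounds over the neighbours except \<open>j\<close> uses up all of
  \<open>x_eq\<close> but the constant 1 and the \<open>j\<close> term, which are the stated lower
  bound. The messages \<open>a\<close> are abstract because the bound serves the iterates, their
  limits and, with \<open>j = i\<close>, the full neighbour sum.\<close>

lemma cavity_bound:
  assumes i: "i < n" and j: "j < n"
    and a: "\<And>k. k < n \<Longrightarrow> a k \<le> \<bar>R $$ (k, i)\<bar> * x k / x i"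
  shows "(1 + \<bar>R $$ (i, j)\<bar> * x j) / x i \<le> 1 - (\<Sum>k\<in>nbrs R i - {j}. a k)"
proof -
  have "(\<Sum>k\<in>nbrs R i - {j}. a k) \<le> (\<Sum>k\<in>nbrs R i - {j}. \<bar>R $$ (i, k)\<bar> * x k / x i)"
  proof (rule sum_mono)
    fix k assume "k \<in> nbrs R i - {j}"
    then have "k < n" by (simp add: nbrs_eq)
    then show "a k \<le> \<bar>R $$ (i, k)\<bar> * x k / x i" using a[of k] sym[of k i] i by simp
  qed
  also have "\<dots> = (x i - 1 - \<bar>R $$ (i, j)\<bar> * x j) / x i"
    by (simp add: sum_nbrs_excl_x[OF i j] sum_divide_distrib[symmetric])
  finally show ?thesis using x_pos[OF i] by (simp add: field_simps)
qed

text \<open>Together with \<open>cavity_bound\<close> this makes the box 0 <= \<alpha> <=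
  \<open>|r| x i / x j\<close> invariant under one update. The summand 1 is given away here and
  saved for the strictness of \<open>edge_potential_pos\<close>.\<close>

lemma message_bound:
  assumes i: "i < n" and j: "j < n" and d: "(1 + \<bar>R $$ (i, j)\<bar> * x j) / x i \<le> d"
  shows "(R $$ (i, j))\<^sup>2 * inverse d \<le> \<bar>R $$ (i, j)\<bar> * x i / x j"
proof -
  let ?r = "\<bar>R $$ (i, j)\<bar>"
  have xi: "x i > 0" and xj: "x j > 0" using x_pos i j by auto
  have "d > 0" using d lower_bound_pos[OF i j] by linarith
  have "?r * x j \<le> x i * d" using d xi by (simp add: field_simps)
  then have "?r * (?r * x j) \<le> ?r * (x i * d)" by (rule mult_left_mono) simp
  then have "?r\<^sup>2 * x j \<le> ?r * x i * d" by (simp add: power2_eq_square mult_ac)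
  then show ?thesis using xj \<open>d > 0\<close> by (simp add: field_simps)
qed

lemma alpha_iter_bounds:
  assumes "i < n" "j < n"
  shows "0 \<le> alpha_iter R t i j \<and> alpha_iter R t i j \<le> \<bar>R $$ (i, j)\<bar> * x i / x j"
  using assms
proof (induction t arbitrary: i j)
  case 0
  then show ?case using x_pos[of i] x_pos[of j] by simp
next
  case (Suc t)
  let ?d = "1 - (\<Sum>k\<in>nbrs R i - {j}. alpha_iter R t k i)"
  have d: "(1 + \<bar>R $$ (i, j)\<bar> * x j) / x i \<le> ?d"
    by (rule cavity_bound) (use Suc in auto)
  then have "?d > 0" using lower_bound_pos[OF Suc.prems] by linarith
  then show ?case using message_bound[OF Suc.prems d] by simp
qed

lemma alpha_iter_denominator:
  assumes "i < n" "j < n"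
  shows "(1 + \<bar>R $$ (i, j)\<bar> * x j) / x i \<le> 1 - (\<Sum>k\<in>nbrs R i - {j}. alpha_iter R t k i)"
  by (rule cavity_bound) (use assms alpha_iter_bounds in auto)

text \<open>Larger incoming messages shrink a denominator that stays positive, so the update is
  monotone; the iteration starts at 0, the bottom of the invariant box.\<close>

lemma alpha_iter_mono:
  assumes "i < n" "j < n"
  shows "alpha_iter R t i j \<le> alpha_iter R (Suc t) i j"
  using assms
proof (induction t arbitrary: i j)
  case 0
  then show ?case using alpha_iter_bounds[of i j "Suc 0"] by simp
next
  case (Suc t)
  let ?d = "\<lambda>t. 1 - (\<Sum>k\<in>nbrs R i - {j}. alpha_iter R t k i)"
  have "?d (Suc t) \<le> ?d t"
    using Suc by (intro diff_left_mono sum_mono) (auto simp: nbrs_eq simp del: alpha_iter.simps)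
  moreover have "?d (Suc t) > 0"
    using alpha_iter_denominator[OF Suc.prems, of "Suc t"] lower_bound_pos[OF Suc.prems] by linarith
  ultimately have "inverse (?d t) \<le> inverse (?d (Suc t))" by (rule le_imp_inverse_le)
  then have "(R $$ (i, j))\<^sup>2 * inverse (?d t) \<le> (R $$ (i, j))\<^sup>2 * inverse (?d (Suc t))"
    by (rule mult_left_mono) simp
  then show ?case by (simp only: alpha_iter.simps(2))
qed

lemma alpha_iter_tendsto:
  assumes "i < n" "j < n"
  shows "(\<lambda>t. alpha_iter R t i j) \<longlonglongrightarrow> alpha R i j"
proof -
  have "incseq (\<lambda>t. alpha_iter R t i j)"
    using alpha_iter_mono[OF assms] by (rule incseq_SucI)
  moreover have "alpha_iter R t i j \<le> \<bar>R $$ (i, j)\<bar> * x i / x j" for t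
    using alpha_iter_bounds[OF assms] by blast
  ultimately obtain l where "(\<lambda>t. alpha_iter R t i j) \<longlonglongrightarrow> l"
    using incseq_convergent by blast
  then show ?thesis unfolding alpha_def by (simp add: limI)
qed

lemma alpha_bounds:
  assumes "i < n" "j < n"
  shows "0 \<le> alpha R i j" "alpha R i j \<le> \<bar>R $$ (i, j)\<bar> * x i / x j"
  using LIMSEQ_le_const[OF alpha_iter_tendsto[OF assms], of 0]
    LIMSEQ_le_const2[OF alpha_iter_tendsto[OF assms], of "\<bar>R $$ (i, j)\<bar> * x i / x j"]
    alpha_iter_bounds[OF assms] by auto

lemma one_minus_alpha_excl_ge:
  assumes "i < n" "j < n"
  shows "(1 + \<bar>R $$ (i, j)\<bar> * x j) / x i \<le> 1 - alpha_excl R i j"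
  unfolding alpha_excl_def by (rule cavity_bound) (use assms alpha_bounds in auto)

lemma one_minus_alpha_excl_pos:
  assumes "i < n" "j < n"
  shows "1 - alpha_excl R i j > 0"
  using one_minus_alpha_excl_ge[OF assms] lower_bound_pos[OF assms] by linarith

text \<open>The update passes to the limit because the limiting denominator is positive. In terms of
  \<open>r_prime\<close> the fixed-point equation has no denominator, which suits the later
  algebra.\<close>

lemma alpha_fixpoint:
  assumes "i < n" "j < n"
  shows "alpha R i j = R $$ (i, j) * r_prime R i j"
proof -
  have "(\<lambda>t. (R $$ (i, j))\<^sup>2 * inverse (1 - (\<Sum>k\<in>nbrs R i - {j}. alpha_iter R t k i)))
      \<longlonglongrightarrow> (R $$ (i, j))\<^sup>2 * inverse (1 - alpha_excl R i j)"
    unfolding alpha_excl_def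
    using one_minus_alpha_excl_pos[OF assms] assms
    by (intro tendsto_intros alpha_iter_tendsto) (auto simp: nbrs_eq alpha_excl_def)
  then have "(\<lambda>t. alpha_iter R (Suc t) i j) \<longlonglongrightarrow> (R $$ (i, j))\<^sup>2 * inverse (1 - alpha_excl R i j)"
    by simp
  moreover have "(\<lambda>t. alpha_iter R (Suc t) i j) \<longlonglongrightarrow> alpha R i j"
    by (rule LIMSEQ_Suc[OF alpha_iter_tendsto[OF assms]])
  ultimately have "alpha R i j = (R $$ (i, j))\<^sup>2 * inverse (1 - alpha_excl R i j)"
    using LIMSEQ_unique by blast
  then show ?thesis by (simp add: r_prime_def power2_eq_square divide_inverse mult_ac)
qed

section \<open>Node and edge factors expressed through the weights r'\<close>

lemma sum_alpha_eq:
  assumes "j \<in> nbrs R i"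
  shows "(\<Sum>k\<in>nbrs R i. alpha R k i) = alpha_excl R i j + alpha R j i"
  unfolding alpha_excl_def using assms by (simp add: sum.remove[of "nbrs R i" j])

lemma one_minus_sum_alpha_pos:
  assumes "i < n"
  shows "1 - (\<Sum>k\<in>nbrs R i. alpha R k i) > 0"
proof -
  \<comment> \<open>Excluding \<open>i\<close> from its own neighbours changes nothing, because the
    diagonal is zero.\<close>
  have "(1 + \<bar>R $$ (i, i)\<bar> * x i) / x i \<le> 1 - (\<Sum>k\<in>nbrs R i - {i}. alpha R k i)"
    by (rule cavity_bound) (use assms alpha_bounds in auto)
  moreover have "nbrs R i - {i} = nbrs R i" using diag[OF assms] by (auto simp: nbrs_eq)
  ultimately show ?thesis using lower_bound_pos[OF assms assms] by simp
qed

text \<open>Restoring the excluded message subtracts \<open>alpha R j i\<close>, which is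
  \<open>r_ij r'_ji\<close>; substituting \<open>r_ij = (1 - alpha_excl R i j) r'_ij\<close> lets
  the cavity factor be pulled out.\<close>

lemma inverse_Z_node_eq:
  assumes "(i, j) \<in> dir_edges R"
  shows "1 - (\<Sum>k\<in>nbrs R i. alpha R k i) = (1 - alpha_excl R i j) * (1 - r_prime R i j * r_prime R j i)"
proof -
  have ij: "i < n" "j < n" "j \<in> nbrs R i" using assms by (auto simp: dir_edges_def nbrs_eq)
  have "(1 - alpha_excl R i j) * r_prime R i j = R $$ (i, j)"
    using one_minus_alpha_excl_pos[OF ij(1,2)] by (simp add: r_prime_def)
  then have "(1 - alpha_excl R i j) * (r_prime R i j * r_prime R j i) = alpha R j i"
    using alpha_fixpoint[OF ij(2,1)] sym[OF ij(1,2)] by (simp add: mult.assoc[symmetric])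
  then show ?thesis using sum_alpha_eq[OF ij(3)] by (simp add: right_diff_distrib)
qed

lemma one_minus_r_prime_prod_pos:
  assumes "(i, j) \<in> dir_edges R"
  shows "1 - r_prime R i j * r_prime R j i > 0"
proof -
  have ij: "i < n" "j < n" using assms by (auto simp: dir_edges_def)
  show ?thesis using inverse_Z_node_eq[OF assms] one_minus_sum_alpha_pos[OF ij(1)]
      one_minus_alpha_excl_pos[OF ij] by (metis zero_less_mult_pos)
qed

lemma Z_node_pos: "i < n \<Longrightarrow> Z_node R i > 0"
  using one_minus_sum_alpha_pos by (simp add: Z_node_def)

text \<open>The left side is the coefficient that \<open>det_nb_matrix\<close> produces. Apart from
  the matrix entry it depends only on the starting vertex, so the reduced matrix will be
  \<open>I - R\<close> with scaled rows.\<close>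

lemma r_prime_div_eq:
  assumes "(i, j) \<in> dir_edges R"
  shows "r_prime R i j / (1 - r_prime R i j * r_prime R j i) = R $$ (i, j) * Z_node R i"
  unfolding Z_node_def inverse_Z_node_eq[OF assms]
  by (simp add: r_prime_def divide_inverse)

text \<open>With cavity factors \<open>a\<close>, \<open>b\<close> and the edge factor
  \<open>p\<close>, the edge determinant is \<open>a b p\<close>, while the node factors are
  \<open>1/(a p)\<close> and \<open>1/(b p)\<close>. Only \<open>p\<close> survives, and it is also
  the factor this edge contributes to the determinant of the reversal part.\<close>

lemma Z_edge_ratio:
  assumes "(i, j) \<in> dir_edges R"
  shows "Z_edge R i j / (Z_node R i * Z_node R j) = 1 - r_prime R i j * r_prime R j i"
proof -
  have ij: "i < n" "j < n" using assms by (auto simp: dir_edges_def)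
  define a b p where "a = 1 - alpha_excl R i j" and "b = 1 - alpha_excl R j i"
    and "p = 1 - r_prime R i j * r_prime R j i"
  have pos: "a > 0" "b > 0" "p > 0"
    using one_minus_alpha_excl_pos ij one_minus_r_prime_prod_pos[OF assms] by (auto simp: a_def b_def p_def)
  have "Z_edge R i j = inverse (a * b - R $$ (i, j) * R $$ (i, j))"
    unfolding Z_edge_def a_def b_def by (subst det_two_by_two) (simp_all add: mat_of_rows_list_def numeral_2_eq_2)
  also have "a * b - R $$ (i, j) * R $$ (i, j) = a * b * p"
    using pos sym[OF ij] by (simp add: p_def r_prime_def a_def[symmetric] b_def[symmetric] field_simps)
  finally have 1: "Z_edge R i j = inverse (a * b * p)" .
  have 2: "Z_node R i = inverse (a * p)"
    unfolding Z_node_def inverse_Z_node_eq[OF assms] a_def p_def ..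
  have 3: "Z_node R j = inverse (b * p)"
    unfolding Z_node_def inverse_Z_node_eq[OF dir_edges_swap[OF assms]] b_def p_def by (simp add: mult_ac)
  show ?thesis unfolding 1 2 3 p_def[symmetric] using pos by (simp add: field_simps)
qed

text \<open>
  In the linear system \<open>(I - |R|) x = 1\<close>, the factor \<open>x\<^sub>i - |r'\<^sub>i\<^sub>j| x\<^sub>j\<close> is the cavity solution at \<open>i\<close>
  after deleting the neighbour \<open>j\<close>.
\<close>

definition edge_potential :: "nat \<times> nat \<Rightarrow> real" where
  "edge_potential = (\<lambda>(i, j). \<bar>R $$ (i, j)\<bar> * (x i - \<bar>r_prime R i j\<bar> * x j))"

lemma edge_potential_pos:
  assumes "e \<in> dir_edges R"
  shows "edge_potential e > 0"
proof -
  obtain i j where e: "e = (i, j)" by force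
  have ij: "i < n" "j < n" "R $$ (i, j) \<noteq> 0" using assms e by (auto simp: dir_edges_def)
  have "1 + \<bar>R $$ (i, j)\<bar> * x j \<le> x i * (1 - alpha_excl R i j)"
    using one_minus_alpha_excl_ge[OF ij(1,2)] x_pos[OF ij(1)] by (simp add: field_simps)
  \<comment> \<open>The summand 1 inherited from \<open>x_eq\<close> gives strictness.\<close>
  then have "\<bar>R $$ (i, j)\<bar> * x j < x i * (1 - alpha_excl R i j)" by linarith
  then have "\<bar>r_prime R i j\<bar> * x j < x i"
    using one_minus_alpha_excl_pos[OF ij(1,2)] by (simp add: r_prime_def abs_divide field_simps)
  then show ?thesis using ij by (simp add: edge_potential_def e)
qed

lemma sum_dir_edges_into:
  assumes "i < n"
  shows "(\<Sum>e\<in>dir_edges R. if snd e = i then g e else 0) = (\<Sum>k\<in>nbrs R i. g (k, i))"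
proof -
  have "(\<Sum>e\<in>dir_edges R. if snd e = i then g e else 0) = (\<Sum>e\<in>{e \<in> dir_edges R. snd e = i}. g e)"
    by (rule sum.inter_filter[symmetric]) (rule finite_subset[of _ "{..<n} \<times> {..<n}"], auto simp: dir_edges_def)
  also have "{e \<in> dir_edges R. snd e = i} = (\<lambda>k. (k, i)) ` nbrs R i"
    using assms sym by (auto simp: dir_edges_def nbrs_eq)
  also have "(\<Sum>e\<in>(\<lambda>k. (k, i)) ` nbrs R i. g e) = (\<Sum>k\<in>nbrs R i. g (k, i))"
    by (subst sum.reindex) (auto intro: inj_onI)
  finally show ?thesis .
qed

text \<open>Nonnegativity of the messages gives \<open>|r_ki| |r'_ki| = alpha R k i\<close>, so the
  incoming potentials add up, by \<open>x_eq\<close>, to an expression in \<open>x i\<close>,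
  \<open>x j\<close> and the cavity sum. Multiplied by \<open>|r'_ij|\<close> it is the potential of
  \<open>f\<close> minus the image of the constant 1.\<close>

lemma sum_edge_potential:
  assumes "f \<in> dir_edges R"
  shows "(\<Sum>e\<in>dir_edges R. edge_potential e * \<bar>nb_entry (\<lambda>(i, j). r_prime R i j) e f\<bar>)
    = edge_potential f - \<bar>(\<lambda>(i, j). r_prime R i j) f\<bar>"
proof -
  obtain i j where f: "f = (i, j)" by force
  have ij: "i < n" "j < n" "j \<in> nbrs R i" using assms f by (auto simp: dir_edges_def nbrs_eq)
  let ?u = "\<bar>r_prime R i j\<bar>" and ?r = "\<bar>R $$ (i, j)\<bar>"
  have "(\<Sum>e\<in>dir_edges R. edge_potential e * \<bar>nb_entry (\<lambda>(i, j). r_prime R i j) e f\<bar>)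
    = (\<Sum>e\<in>dir_edges R. if snd e = i then (if fst e \<noteq> j then edge_potential e * ?u else 0) else 0)"
    by (rule sum.cong) (auto simp: nb_entry_def f)
  also have "\<dots> = (\<Sum>k\<in>nbrs R i. if k \<noteq> j then edge_potential (k, i) * ?u else 0)"
    by (subst sum_dir_edges_into[OF ij(1)]) simp
  also have "\<dots> = (\<Sum>k\<in>nbrs R i - {j}. edge_potential (k, i) * ?u)"
    by (rule sum.mono_neutral_cong_right) auto
  also have "\<dots> = (\<Sum>k\<in>nbrs R i - {j}. edge_potential (k, i)) * ?u"
    by (rule sum_distrib_right[symmetric])
  also have "(\<Sum>k\<in>nbrs R i - {j}. edge_potential (k, i))
      = (\<Sum>k\<in>nbrs R i - {j}. \<bar>R $$ (i, k)\<bar> * x k - alpha R k i * x i)"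
  proof (rule sum.cong)
    fix k assume "k \<in> nbrs R i - {j}"
    then have k: "k < n" by (simp add: nbrs_eq)
    have "alpha R k i = \<bar>R $$ (k, i)\<bar> * \<bar>r_prime R k i\<bar>"
      using alpha_fixpoint[OF k ij(1)] alpha_bounds(1)[OF k ij(1)] by (metis abs_mult abs_of_nonneg)
    then show "edge_potential (k, i) = \<bar>R $$ (i, k)\<bar> * x k - alpha R k i * x i"
      using sym[OF k ij(1)] by (simp add: edge_potential_def algebra_simps)
  qed simp
  also have "\<dots> = x i - 1 - ?r * x j - alpha_excl R i j * x i"
    by (simp add: sum_subtractf sum_nbrs_excl_x[OF ij(1,2)] alpha_excl_def sum_distrib_right)
  also have "(x i - 1 - ?r * x j - alpha_excl R i j * x i) * ?u = ?r * (x i - ?u * x j) - ?u"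
  proof -
    have "?u * (1 - alpha_excl R i j) = ?r"
      using one_minus_alpha_excl_pos[OF ij(1,2)] by (simp add: r_prime_def abs_divide)
    then have "?r * x i = ?u * (1 - alpha_excl R i j) * x i" by simp
    then show ?thesis by (simp add: algebra_simps)
  qed
  finally show ?thesis by (simp add: edge_potential_def f)
qed

text \<open>Each edge loses the positive amount |r'|, and finitely many relative losses have a
  uniform lower bound.\<close>

lemma edge_potential_contraction:
  obtains \<theta> where "0 \<le> \<theta>" "\<theta> < 1"
    and "\<And>f. f \<in> dir_edges R \<Longrightarrow>
      (\<Sum>e\<in>dir_edges R. edge_potential e * \<bar>nb_entry (\<lambda>(i, j). r_prime R i j) e f\<bar>) \<le> \<theta> * edge_potential f"
proof -
  let ?u = "\<lambda>(i, j). r_prime R i j"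
  let ?q = "\<lambda>f. 1 - \<bar>?u f\<bar> / edge_potential f"
  \<comment> \<open>Inserting 0 covers a graph without edges and makes \<theta> nonnegative.\<close>
  define \<theta> where "\<theta> = Max (insert 0 (?q ` dir_edges R))"
  have fin: "finite (insert 0 (?q ` dir_edges R))"
    using finite_subset[of "dir_edges R" "{..<n} \<times> {..<n}"] by (auto simp: dir_edges_def)
  have "?q f < 1" if f: "f \<in> dir_edges R" for f
  proof -
    obtain i j where e: "f = (i, j)" by force
    have ij: "i < n" "j < n" "R $$ (i, j) \<noteq> 0" using f e by (auto simp: dir_edges_def)
    have "?u f \<noteq> 0" using ij one_minus_alpha_excl_pos[OF ij(1,2)] by (auto simp: e r_prime_def)
    then show ?thesis using edge_potential_pos[OF f] by simp
  qed
  then have "\<theta> < 1" unfolding \<theta>_def using fin by (subst Max_less_iff) auto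
  moreover have "0 \<le> \<theta>" unfolding \<theta>_def using fin by (intro Max_ge) auto
  moreover have "(\<Sum>e\<in>dir_edges R. edge_potential e * \<bar>nb_entry ?u e f\<bar>) \<le> \<theta> * edge_potential f"
    if f: "f \<in> dir_edges R" for f
  proof -
    have "?q f \<le> \<theta>" unfolding \<theta>_def using fin f by (intro Max_ge) auto
    then have "?q f * edge_potential f \<le> \<theta> * edge_potential f"
      using edge_potential_pos[OF f] by (intro mult_right_mono) auto
    then show ?thesis using edge_potential_pos[OF f]
      by (simp add: sum_edge_potential[OF f] left_diff_distrib)
  qed
  ultimately show ?thesis using that[of \<theta>] by blast
qed

section \<open>Evaluating the non-backtracking determinant\<close>

abbreviation r' :: "nat \<times> nat \<Rightarrow> real" where
  "r' \<equiv> \<lambda>(i, j). r_prime R i j"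

lemma undir_edges_subset: "undir_edges R \<subseteq> dir_edges R"
  by (auto simp: undir_edges_def dir_edges_def)

text \<open>The zero diagonal excludes loops, so exactly one orientation of each edge is increasing
  and the other is its swap.\<close>

lemma bij_betw_edge_enum:
  assumes b: "bij_betw b {..<m} (undir_edges R)"
  shows "bij_betw (edge_enum m b) {..<2 * m} (dir_edges R)"
proof -
  let ?U = "undir_edges R"
  have 1: "bij_betw (edge_enum m b) {..<m} ?U"
    using b by (rule bij_betw_cong[THEN iffD1, rotated]) (simp add: edge_enum_def)
  have sh: "bij_betw (\<lambda>s. s - m) {m..<2 * m} {..<m}"
    by (rule bij_betw_byWitness[where f' = "\<lambda>s. s + m"]) auto
  have sw: "bij_betw prod.swap ?U (prod.swap ` ?U)" by (rule bij_betw_imageI) auto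
  have "bij_betw (prod.swap \<circ> (b \<circ> (\<lambda>s. s - m))) {m..<2 * m} (prod.swap ` ?U)"
    by (intro bij_betw_trans[OF _ sw] bij_betw_trans[OF sh b])
  then have 2: "bij_betw (edge_enum m b) {m..<2 * m} (prod.swap ` ?U)"
    by (rule bij_betw_cong[THEN iffD1, rotated]) (simp add: edge_enum_def)
  have "?U \<inter> prod.swap ` ?U = {}" by (auto simp: undir_edges_def)
  from bij_betw_combine[OF 1 2 this]
  have "bij_betw (edge_enum m b) ({..<m} \<union> {m..<2 * m}) (?U \<union> prod.swap ` ?U)" .
  moreover have "{..<m} \<union> {m..<2 * m} = {..<2 * m}" by auto
  moreover have "?U \<union> prod.swap ` ?U = dir_edges R"
  proof (intro equalityI subsetI)
    fix e assume e: "e \<in> dir_edges R"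
    obtain i j where ij: "e = (i, j)" by force
    have "i \<noteq> j" using e diag by (auto simp: ij dir_edges_def)
    then consider "i < j" | "j < i" by linarith
    then show "e \<in> ?U \<union> prod.swap ` ?U"
    proof cases
      case 1
      then show ?thesis using e by (auto simp: ij undir_edges_def dir_edges_def)
    next
      case 2
      then have "(j, i) \<in> ?U" using dir_edges_swap[of i j] e by (auto simp: ij undir_edges_def dir_edges_def)
      then show ?thesis unfolding ij by (auto intro: rev_image_eqI)
    qed
  next
    fix e assume "e \<in> ?U \<union> prod.swap ` ?U"
    then have "e \<in> ?U \<or> prod.swap e \<in> ?U" by auto
    then show "e \<in> dir_edges R"
      using undir_edges_subset dir_edges_swap[of "snd e" "fst e"] by (cases e) auto
  qed
  ultimately show ?thesis by simp
qed

lemma Z_bp_eq: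
  "Z_bp R = (\<Prod>i<n. Z_node R i) * (\<Prod>(i, j)\<in>undir_edges R. 1 - r_prime R i j * r_prime R j i)"
proof -
  have "(\<Prod>(i, j)\<in>undir_edges R. Z_edge R i j / (Z_node R i * Z_node R j))
      = (\<Prod>(i, j)\<in>undir_edges R. 1 - r_prime R i j * r_prime R j i)"
  proof (rule prod.cong, rule refl)
    fix e assume "e \<in> undir_edges R"
    then have "e \<in> dir_edges R" using undir_edges_subset by blast
    then show "(case e of (i, j) \<Rightarrow> Z_edge R i j / (Z_node R i * Z_node R j))
      = (case e of (i, j) \<Rightarrow> 1 - r_prime R i j * r_prime R j i)"
      using Z_edge_ratio by (cases e) auto
  qed
  then show ?thesis by (simp add: Z_bp_def)
qed

lemma Z_bp_nonzero: "Z_bp R \<noteq> 0"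
proof -
  have "finite (undir_edges R)" using finite_subset[OF undir_edges_subset finite_dir_edges] .
  moreover have "(case e of (i, j) \<Rightarrow> 1 - r_prime R i j * r_prime R j i) \<noteq> 0"
    if "e \<in> undir_edges R" for e
    using one_minus_r_prime_prod_pos[of "fst e" "snd e"] that undir_edges_subset
    by (auto simp: case_prod_unfold)
  moreover have "Z_node R i \<noteq> 0" if "i < n" for i using Z_node_pos[OF that] by simp
  ultimately show ?thesis by (simp add: Z_bp_eq)
qed

lemma sum_dir_edges_from:
  assumes "i < n"
  shows "(\<Sum>e\<in>dir_edges R. if fst e = i then g e else 0) = (\<Sum>k\<in>nbrs R i. g (i, k))"
proof -
  have "(\<Sum>e\<in>dir_edges R. if fst e = i then g e else 0) = (\<Sum>e\<in>{e \<in> dir_edges R. fst e = i}. g e)"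
    by (rule sum.inter_filter[symmetric]) (rule finite_dir_edges)
  also have "{e \<in> dir_edges R. fst e = i} = (\<lambda>k. (i, k)) ` nbrs R i"
    using assms by (auto simp: dir_edges_def nbrs_eq)
  also have "(\<Sum>e\<in>(\<lambda>k. (i, k)) ` nbrs R i. g e) = (\<Sum>k\<in>nbrs R i. g (i, k))"
    by (subst sum.reindex) (auto intro: inj_onI)
  finally show ?thesis .
qed

text \<open>Each outgoing edge \<open>(i, k)\<close> contributes \<open>Z_i r_ik\<close> at column
  \<open>k\<close> and \<open>- Z_i alpha R k i\<close> on the diagonal. The diagonal total is
  \<open>Z_i\<close> because \<open>Z_i\<close> inverts one minus the sum of incoming
  messages.\<close>

lemma reduced_entry:
  assumes i: "i < n" and j: "j < n"
  shows "(if i = j then 1 else 0)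
     - (\<Sum>e\<in>dir_edges R. (if fst e = i then r' e else 0)
          * ((if snd e = j then 1 else 0) - (if fst e = j then r' (prod.swap e) else 0))
          / (1 - r' e * r' (prod.swap e)))
     = Z_node R i * ((if i = j then 1 else 0) - R $$ (i, j))"
proof -
  let ?Z = "Z_node R i"
  have "(\<Sum>e\<in>dir_edges R. (if fst e = i then r' e else 0)
          * ((if snd e = j then 1 else 0) - (if fst e = j then r' (prod.swap e) else 0))
          / (1 - r' e * r' (prod.swap e)))
    = (\<Sum>e\<in>dir_edges R. if fst e = i then r' e / (1 - r' e * r' (prod.swap e))
          * ((if snd e = j then 1 else 0) - (if fst e = j then r' (prod.swap e) else 0)) else 0)"
    by (rule sum.cong) auto
  also have "\<dots> = (\<Sum>k\<in>nbrs R i. r_prime R i k / (1 - r_prime R i k * r_prime R k i)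
          * ((if k = j then 1 else 0) - (if i = j then r_prime R k i else 0)))"
    by (subst sum_dir_edges_from[OF i]) (rule sum.cong, auto)
  also have "\<dots> = (\<Sum>k\<in>nbrs R i. ?Z * (if k = j then R $$ (i, j) else 0)
      - ?Z * (if i = j then alpha R k i else 0))"
  proof (rule sum.cong)
    fix k assume k: "k \<in> nbrs R i"
    then have "k < n" by (simp add: nbrs_eq)
    have "r_prime R i k / (1 - r_prime R i k * r_prime R k i) = R $$ (i, k) * ?Z"
      using k i by (intro r_prime_div_eq) (simp add: dir_edges_iff)
    then show "r_prime R i k / (1 - r_prime R i k * r_prime R k i)
          * ((if k = j then 1 else 0) - (if i = j then r_prime R k i else 0))
      = ?Z * (if k = j then R $$ (i, j) else 0) - ?Z * (if i = j then alpha R k i else 0)"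
      using alpha_fixpoint[OF \<open>k < n\<close> i] sym[OF i \<open>k < n\<close>] by (auto simp: algebra_simps)
  qed simp
  also have "\<dots> = ?Z * R $$ (i, j) - ?Z * (if i = j then (\<Sum>k\<in>nbrs R i. alpha R k i) else 0)"
    using j by (simp add: sum_subtractf sum_distrib_left[symmetric] sum.delta nbrs_eq)
  finally have *: "(\<Sum>e\<in>dir_edges R. (if fst e = i then r' e else 0)
          * ((if snd e = j then 1 else 0) - (if fst e = j then r' (prod.swap e) else 0))
          / (1 - r' e * r' (prod.swap e)))
      = ?Z * R $$ (i, j) - ?Z * (if i = j then (\<Sum>k\<in>nbrs R i. alpha R k i) else 0)" .
  have "?Z * (1 - (\<Sum>k\<in>nbrs R i. alpha R k i)) = 1"
    using one_minus_sum_alpha_pos[OF i] by (simp add: Z_node_def)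
  then have "1 + ?Z * (\<Sum>k\<in>nbrs R i. alpha R k i) = ?Z" by (simp add: algebra_simps)
  then show ?thesis unfolding * by (auto simp: algebra_simps)
qed

lemma det_scaled_rows:
  "det (mat n n (\<lambda>(i, j). z i * ((if i = j then 1 else 0) - R $$ (i, j))))
     = (\<Prod>i<n. z i) * det (1\<^sub>m n - R)"
proof -
  define D where "D = mat n n (\<lambda>(i, j). if i = j then z i else 0)"
  have D: "D \<in> carrier_mat n n" by (simp add: D_def)
  have S: "1\<^sub>m n - R \<in> carrier_mat n n" using carrier by (rule minus_carrier_mat)
  have "mat n n (\<lambda>(i, j). z i * ((if i = j then 1 else 0) - R $$ (i, j))) = D * (1\<^sub>m n - R)" (is "?L = _")
  proof (rule eq_matI)
    fix i j assume "i < dim_row (D * (1\<^sub>m n - R))" "j < dim_col (D * (1\<^sub>m n - R))"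
    then have ij: "i < n" "j < n" by (simp_all add: D_def)
    have "(D * (1\<^sub>m n - R)) $$ (i, j) = (\<Sum>c<n. D $$ (i, c) * (1\<^sub>m n - R) $$ (c, j))"
      by (rule index_mult_mat_sum[OF D S ij])
    also have "\<dots> = (\<Sum>c<n. if c = i then z i * ((if i = j then 1 else 0) - R $$ (i, j)) else 0)"
      using ij by (intro sum.cong) (auto simp: D_def)
    also have "\<dots> = ?L $$ (i, j)" using ij by (simp add: sum.delta)
    finally show "?L $$ (i, j) = (D * (1\<^sub>m n - R)) $$ (i, j)" by (rule HOL.sym)
  qed (simp_all add: D_def)
  then have "det ?L = det D * det (1\<^sub>m n - R)" using det_mult[OF D S] by (simp only:)
  moreover have "det D = prod_list (diag_mat D)"
    by (rule det_upper_triangular[OF _ D]) (auto simp: D_def)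
  moreover have "prod_list (diag_mat D) = (\<Prod>i<n. z i)"
    by (simp add: prod_list_diag_prod lessThan_atLeast0 D_def)
  ultimately show ?thesis by (simp only:)
qed

text \<open>The reversal part supplies the edge factors of \<open>Z_bp\<close> and the row scaling
  of the reduced matrix supplies its node factors, leaving \<open>det (I - R)\<close>.\<close>

lemma det_nb_eq_Z_bp:
  assumes b: "bij_betw b {..<m} (undir_edges R)"
  shows "det (1\<^sub>m (2 * m) - mat (2 * m) (2 * m) (\<lambda>(s, t). nb_entry r' (edge_enum m b s) (edge_enum m b t)))
    = Z_bp R * det (1\<^sub>m n - R)"
proof -
  let ?\<epsilon> = "edge_enum m b"
  note bij = bij_betw_edge_enum[OF b]
  have mem: "?\<epsilon> s \<in> dir_edges R" if "s < 2 * m" for s using bij that by (auto simp: bij_betw_def)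
  have "det (1\<^sub>m (2 * m) - mat (2 * m) (2 * m) (\<lambda>(s, t). nb_entry r' (?\<epsilon> s) (?\<epsilon> t)))
    = (\<Prod>s<m. 1 - r' (b s) * r' (prod.swap (b s)))
      * det (mat n n (\<lambda>(i, j). (if i = j then 1 else 0)
          - (\<Sum>s<2 * m. (if fst (?\<epsilon> s) = i then r' (?\<epsilon> s) else 0)
              * ((if snd (?\<epsilon> s) = j then 1 else 0) - (if fst (?\<epsilon> s) = j then r' (prod.swap (?\<epsilon> s)) else 0))
              / (1 - r' (?\<epsilon> s) * r' (prod.swap (?\<epsilon> s))))))"
  proof (rule det_nb_matrix)
    show "fst (?\<epsilon> s) < n \<and> snd (?\<epsilon> s) < n" if "s < 2 * m" for s
      using mem[OF that] by (auto simp: dir_edges_def)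
    show "inj_on ?\<epsilon> {..<2 * m}" using bij by (simp add: bij_betw_def)
    show "1 - r' (?\<epsilon> s) * r' (prod.swap (?\<epsilon> s)) \<noteq> 0" if "s < 2 * m" for s
      using one_minus_r_prime_prod_pos[of "fst (?\<epsilon> s)" "snd (?\<epsilon> s)"] mem[OF that]
      by (simp add: case_prod_unfold)
  qed
  also have "(\<Prod>s<m. 1 - r' (b s) * r' (prod.swap (b s)))
      = (\<Prod>(i, j)\<in>undir_edges R. 1 - r_prime R i j * r_prime R j i)"
    using prod.reindex_bij_betw[OF b, of "\<lambda>e. 1 - r' e * r' (prod.swap e)"]
    by (simp add: case_prod_unfold)
  also have "mat n n (\<lambda>(i, j). (if i = j then 1 else 0)
          - (\<Sum>s<2 * m. (if fst (?\<epsilon> s) = i then r' (?\<epsilon> s) else 0)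
              * ((if snd (?\<epsilon> s) = j then 1 else 0) - (if fst (?\<epsilon> s) = j then r' (prod.swap (?\<epsilon> s)) else 0))
              / (1 - r' (?\<epsilon> s) * r' (prod.swap (?\<epsilon> s)))))
      = mat n n (\<lambda>(i, j). Z_node R i * ((if i = j then 1 else 0) - R $$ (i, j)))"
    (is "mat n n ?f = mat n n ?g")
  proof (rule cong_mat)
    fix i j assume ij: "i < n" "j < n"
    show "?f (i, j) = ?g (i, j)"
      unfolding prod.case
      by (subst sum.reindex_bij_betw[OF bij, of "\<lambda>e. (if fst e = i then r' e else 0)
          * ((if snd e = j then 1 else 0) - (if fst e = j then r' (prod.swap e) else 0))
          / (1 - r' e * r' (prod.swap e))"]) (rule reduced_entry[OF ij])
  qed auto
  also have "det \<dots> = (\<Prod>i<n. Z_node R i) * det (1\<^sub>m n - R)" by (rule det_scaled_rows)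
  finally show ?thesis by (simp add: Z_bp_eq mult_ac)
qed

end

section \<open>The product over orbits\<close>

text \<open>Kept free of division and stated for arbitrary lists of pairs, so that induction can
  peel off one factor at a time.\<close>

lemma prod_list_weighted_le:
  fixes M :: "'a \<Rightarrow> 'a \<Rightarrow> real"
  assumes "\<And>a b. (a, b) \<in> set ps \<Longrightarrow> v a > 0 \<and> v b > 0 \<and> v a * \<bar>M a b\<bar> \<le> \<theta> * v b" and "\<theta> \<ge> 0"
  shows "\<bar>\<Prod>(a, b)\<leftarrow>ps. M a b\<bar> * prod_list (map v (map fst ps))
    \<le> \<theta> ^ length ps * prod_list (map v (map snd ps))"
  using assms(1)
proof (induction ps)
  case (Cons p ps)
  obtain a b where p: "p = (a, b)" by force
  have ab: "v a > 0" "v b > 0" "v a * \<bar>M a b\<bar> \<le> \<theta> * v b" using Cons.prems[of a b] p by auto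
  have IH: "\<bar>\<Prod>(a, b)\<leftarrow>ps. M a b\<bar> * prod_list (map v (map fst ps))
    \<le> \<theta> ^ length ps * prod_list (map v (map snd ps))"
    by (rule Cons.IH) (use Cons.prems in auto)
  have nn: "0 \<le> \<bar>\<Prod>(a, b)\<leftarrow>ps. M a b\<bar> * prod_list (map v (map fst ps))"
  proof -
    have "0 \<le> v (fst q)" if "q \<in> set ps" for q
      using Cons.prems[of "fst q" "snd q"] that by simp
    then show ?thesis by (intro mult_nonneg_nonneg prod_list_nonneg) auto
  qed
  have "(v a * \<bar>M a b\<bar>) * (\<bar>\<Prod>(a, b)\<leftarrow>ps. M a b\<bar> * prod_list (map v (map fst ps)))
    \<le> (\<theta> * v b) * (\<theta> ^ length ps * prod_list (map v (map snd ps)))"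
    using ab assms(2) by (intro mult_mono[OF ab(3) IH _ nn]) auto
  then show ?case by (simp add: p abs_mult mult_ac)
qed simp

text \<open>Rescaling changes the factor \<open>M a b\<close> by the ratio \<open>v a / v b\<close>,
  and these ratios cancel around a cyclic word.\<close>

lemma abs_cyclic_weight_le:
  fixes M :: "'a \<Rightarrow> 'a \<Rightarrow> real"
  assumes v: "\<And>a. a \<in> S \<Longrightarrow> v a > 0" and "\<theta> \<ge> 0"
    and le: "\<And>a b. a \<in> S \<Longrightarrow> b \<in> S \<Longrightarrow> v a * \<bar>M a b\<bar> \<le> \<theta> * v b" and es: "set es \<subseteq> S"
  shows "\<bar>cyclic_weight M es\<bar> \<le> \<theta> ^ length es"
proof -
  let ?ps = "zip es (rotate1 es)"
  have ps: "v a > 0 \<and> v b > 0 \<and> v a * \<bar>M a b\<bar> \<le> \<theta> * v b" if "(a, b) \<in> set ?ps" for a b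
  proof -
    have "a \<in> S" "b \<in> S" using set_zip_leftD[OF that] set_zip_rightD[OF that] es by auto
    then show ?thesis using v le by blast
  qed
  have pos: "prod_list (map v es) > 0" using es v by (induction es) auto
  have "\<bar>cyclic_weight M es\<bar> * prod_list (map v es) \<le> \<theta> ^ length es * prod_list (map v (rotate1 es))"
    using prod_list_weighted_le[of ?ps v M \<theta>, OF ps assms(2)] by (simp add: cyclic_weight_def)
  also have "prod_list (map v (rotate1 es)) = prod_list (map v es)"
    using prod_list_map_rotate[of v 1 es] by simp
  finally show ?thesis using pos by simp
qed

lemma cyclic_weight_nb_entry:
  assumes "es \<noteq> []" "set es \<subseteq> dir_edges R"
  shows "cyclic_weight (nb_entry u) es
    = (if cyclic_path R es \<and> no_backtrack es then prod_list (map u es) else (0::real))"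
proof -
  let ?ps = "zip es (rotate1 es)"
  have "map snd es = rotate1 (map fst es) \<longleftrightarrow> list_all2 (\<lambda>e f. snd e = fst f) es (rotate1 es)"
    by (simp add: rotate1_map list_eq_iff_nth_eq list_all2_conv_all_nth)
  then have "cyclic_path R es \<longleftrightarrow> (\<forall>(e, f)\<in>set ?ps. snd e = fst f)"
    using assms by (simp add: cyclic_path_def list_all2_iff)
  then have good: "cyclic_path R es \<and> no_backtrack es
      \<longleftrightarrow> (\<forall>p\<in>set ?ps. snd (fst p) = fst (snd p) \<and> snd p \<noteq> (snd (fst p), fst (fst p)))"
    unfolding no_backtrack_def by (auto simp: case_prod_unfold)
  show ?thesis
  proof (cases "cyclic_path R es \<and> no_backtrack es")
    case True
    then have "(\<lambda>(e, f). nb_entry u e f) q = u (snd q)" if "q \<in> set ?ps" for q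
      using that unfolding good by (cases q) (auto simp: nb_entry_def)
    then have "map (\<lambda>(e, f). nb_entry u e f) ?ps = map (\<lambda>p. u (snd p)) ?ps"
      by (intro map_cong refl)
    also have "\<dots> = map u (map snd ?ps)" by (simp only: map_map comp_def)
    \<comment> \<open>The weights are those of the second components, so the product runs over the
      rotated word.\<close>
    also have "map snd ?ps = rotate1 es" by simp
    finally have "cyclic_weight (nb_entry u) es = prod_list (map u (rotate1 es))"
      unfolding cyclic_weight_def by (simp only:)
    then show ?thesis using True prod_list_map_rotate[of u 1 es] by simp
  next
    case False
    then obtain p where p: "p \<in> set ?ps" "\<not> (snd (fst p) = fst (snd p) \<and> snd p \<noteq> (snd (fst p), fst (fst p)))"
      unfolding good by blast
    then have "(\<lambda>(e, f). nb_entry u e f) p = 0" by (auto simp: nb_entry_def case_prod_unfold)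
    then have "0 \<in> set (map (\<lambda>(e, f). nb_entry u e f) ?ps)" using p(1) by (metis image_eqI set_map)
    then show ?thesis using False unfolding cyclic_weight_def by (simp only: prod_list_zero_iff if_False)
  qed
qed

lemma neg_ln_has_sum:
  fixes w :: real
  assumes "\<bar>w\<bar> < 1"
  shows "((\<lambda>m. w ^ m / real m) has_sum (- ln (1 - w))) {1..}"
proof -
  have s: "(\<lambda>m. y ^ m / real m) sums (- ln (1 - y))" if "\<bar>y\<bar> < 1" for y :: real
  proof -
    have "(\<lambda>m. - (- ((- (- y)) ^ m) / real m)) sums (- ln (1 + - y))"
      by (intro sums_minus ln_series') (use that in simp)
    then show ?thesis by simp
  qed
  \<comment> \<open>The same series at |w| gives the absolute convergence that an unordered sum
    requires.\<close>
  have "summable (\<lambda>m. norm (w ^ m / real m))"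
    using sums_summable[OF s[of "\<bar>w\<bar>"]] assms by (simp add: power_abs)
  then have "((\<lambda>m. w ^ m / real m) has_sum (- ln (1 - w))) UNIV"
    using s[OF assms] by (rule norm_summable_imp_has_sum)
  \<comment> \<open>The term at 0 may be dropped: it is a division by zero, hence zero.\<close>
  then show ?thesis
    by (rule has_sum_cong_neutral[THEN iffD1, rotated -1]) auto
qed

lemma lists_minus_Nil: "lists S - {[]} = {es. es \<noteq> [] \<and> set es \<subseteq> S}"
  by (auto simp: lists_eq_set)

context strictly_superharmonic
begin

text \<open>Matrix results speak of index words. They are transported along the edge enumeration,
  which does not occur in the conclusion.\<close>

lemma nb_words_has_sum:
  obtains L where "exp L = inverse (Z_bp R * det (1\<^sub>m n - R))"
    and "((\<lambda>es. cyclic_weight (nb_entry r') es / real (length es)) has_sum L)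
      {es. es \<noteq> [] \<and> set es \<subseteq> dir_edges R}"
proof -
  define m where "m = card (undir_edges R)"
  have "finite (undir_edges R)" using finite_subset[OF undir_edges_subset finite_dir_edges] .
  from ex_bij_betw_nat_finite[OF this] obtain b where b: "bij_betw b {..<m} (undir_edges R)"
    by (auto simp: m_def lessThan_atLeast0)
  define \<epsilon> where "\<epsilon> = edge_enum m b"
  define N where "N = 2 * m"
  have bij: "bij_betw \<epsilon> {..<N} (dir_edges R)"
    unfolding \<epsilon>_def N_def by (rule bij_betw_edge_enum[OF b])
  have mem: "\<epsilon> s \<in> dir_edges R" if "s < N" for s using bij that by (auto simp: bij_betw_def)
  define A where "A = mat N N (\<lambda>(s, t). nb_entry r' (\<epsilon> s) (\<epsilon> t))"
  have A: "A \<in> carrier_mat N N" by (simp add: A_def)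
  obtain \<theta> where \<theta>: "0 \<le> \<theta>" "\<theta> < 1"
    and contr: "\<And>f. f \<in> dir_edges R \<Longrightarrow>
      (\<Sum>e\<in>dir_edges R. edge_potential e * \<bar>nb_entry r' e f\<bar>) \<le> \<theta> * edge_potential f"
    using edge_potential_contraction by blast
  have v: "edge_potential (\<epsilon> s) > 0" if "s < N" for s using edge_potential_pos mem[OF that] by blast
  have bd: "(\<Sum>s<N. edge_potential (\<epsilon> s) * \<bar>A $$ (s, t)\<bar>) \<le> \<theta> * edge_potential (\<epsilon> t)" if t: "t < N" for t
  proof -
    have "(\<Sum>s<N. edge_potential (\<epsilon> s) * \<bar>A $$ (s, t)\<bar>)
        = (\<Sum>s<N. edge_potential (\<epsilon> s) * \<bar>nb_entry r' (\<epsilon> s) (\<epsilon> t)\<bar>)"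
      using t by (intro sum.cong) (auto simp: A_def)
    also have "\<dots> = (\<Sum>e\<in>dir_edges R. edge_potential e * \<bar>nb_entry r' e (\<epsilon> t)\<bar>)"
      by (rule sum.reindex_bij_betw[OF bij])
    finally show ?thesis using contr[OF mem[OF t]] by simp
  qed
  obtain L where L: "(\<lambda>k. mat_trace (A ^\<^sub>m Suc k) / real (Suc k)) sums L"
    and eL: "exp L = inverse (det (1\<^sub>m N - A))"
    using trace_log_series[OF A v bd \<theta>(2)] by blast
  have "det (1\<^sub>m N - A) = Z_bp R * det (1\<^sub>m n - R)"
    unfolding A_def N_def \<epsilon>_def by (rule det_nb_eq_Z_bp[OF b])
  then have "exp L = inverse (Z_bp R * det (1\<^sub>m n - R))" using eL by simp
  moreover have "((\<lambda>es. cyclic_weight (nb_entry r') es / real (length es)) has_sum L)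
      {es. es \<noteq> [] \<and> set es \<subseteq> dir_edges R}"
  proof -
    have "((\<lambda>es. cyclic_weight (\<lambda>s t. A $$ (s, t)) es / real (length es)) has_sum L)
      {es. es \<noteq> [] \<and> set es \<subseteq> {..<N}}"
      by (rule cyclic_weight_has_sum[OF A v bd \<theta> L])
    moreover have "cyclic_weight (\<lambda>s t. A $$ (s, t)) es / real (length es)
        = cyclic_weight (nb_entry r') (map \<epsilon> es) / real (length (map \<epsilon> es))"
      if es: "es \<in> {es. es \<noteq> [] \<and> set es \<subseteq> {..<N}}" for es
    proof -
      have z: "zip (map \<epsilon> es) (rotate1 (map \<epsilon> es)) = map (\<lambda>(s, t). (\<epsilon> s, \<epsilon> t)) (zip es (rotate1 es))"
        by (simp add: rotate1_map zip_map_map)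
      have "A $$ (s, t) = nb_entry r' (\<epsilon> s) (\<epsilon> t)" if "(s, t) \<in> set (zip es (rotate1 es))" for s t
      proof -
        have "s < N" "t < N" using set_zip_leftD[OF that] set_zip_rightD[OF that] es by auto
        then show ?thesis by (simp add: A_def)
      qed
      then have q: "map (\<lambda>(s, t). A $$ (s, t)) (zip es (rotate1 es))
        = map (\<lambda>(s, t). nb_entry r' (\<epsilon> s) (\<epsilon> t)) (zip es (rotate1 es))"
        by (intro map_cong refl) auto
      show ?thesis
        unfolding cyclic_weight_def z q map_map by (simp add: comp_def case_prod_unfold)
    qed
    ultimately have "((\<lambda>es. cyclic_weight (nb_entry r') (map \<epsilon> es) / real (length (map \<epsilon> es))) has_sum L)
      {es. es \<noteq> [] \<and> set es \<subseteq> {..<N}}"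
      by (simp only: cong: has_sum_cong)
    moreover have "bij_betw (map \<epsilon>) {es. es \<noteq> [] \<and> set es \<subseteq> {..<N}} {es. es \<noteq> [] \<and> set es \<subseteq> dir_edges R}"
    proof -
      have "bij_betw (map \<epsilon>) (lists {..<N} - {[]}) (lists (dir_edges R) - {[]})"
        using bij_betw_DiffI[OF bij_lists[OF bij], of "{[]}" "{[]}"] by (simp add: bij_betw_def)
      then show ?thesis by (simp only: lists_minus_Nil)
    qed
    ultimately show ?thesis
      by (simp only: has_sum_reindex_bij_betw[of _ _ _ "\<lambda>es. cyclic_weight (nb_entry r') es / real (length es)"])
  qed
  ultimately show ?thesis by (rule that)
qed

text \<open>Needed to expand the logarithm of each orbit factor. The column contraction bounds every
  single entry of \<open>M\<close>, hence every cyclic product by a positive power of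
  \<theta>.\<close>

lemma abs_orbit_weight_less_1:
  assumes "\<gamma> \<in> backtrackless_orbits R"
  shows "\<bar>orbit_weight R \<gamma>\<bar> < 1"
proof -
  have o: "\<gamma> \<in> orbits R" "backtrackless \<gamma>" using assms by (auto simp: backtrackless_orbits_def)
  define p where "p = orbit_steps \<gamma>"
  have p: "p \<in> steps ` \<gamma>" unfolding p_def by (rule orbit_steps_mem[OF o(1)])
  have c: "cyclic_path R p" by (rule steps_image_orbit(4)[OF o(1) p])
  then have pE: "p \<noteq> []" "set p \<subseteq> dir_edges R" by (auto simp: cyclic_path_def)
  have "orbit_weight R \<gamma> = cyclic_weight (nb_entry r') p"
    using cyclic_weight_nb_entry[OF pE, of r'] c backtrackless_iff[OF o(1) p] o(2)
      orbit_weight_eq[OF o(1) p] by simp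
  moreover obtain \<theta> where \<theta>: "0 \<le> \<theta>" "\<theta> < 1"
    and contr: "\<And>f. f \<in> dir_edges R \<Longrightarrow>
      (\<Sum>e\<in>dir_edges R. edge_potential e * \<bar>nb_entry r' e f\<bar>) \<le> \<theta> * edge_potential f"
    using edge_potential_contraction by blast
  have "edge_potential e * \<bar>nb_entry r' e f\<bar> \<le> \<theta> * edge_potential f"
    if "e \<in> dir_edges R" "f \<in> dir_edges R" for e f
  proof -
    have "edge_potential e * \<bar>nb_entry r' e f\<bar> \<le> (\<Sum>e\<in>dir_edges R. edge_potential e * \<bar>nb_entry r' e f\<bar>)"
      by (rule member_le_sum) (use that edge_potential_pos in \<open>auto simp: finite_dir_edges intro!: mult_nonneg_nonneg intro: less_imp_le\<close>)
    then show ?thesis using contr[OF that(2)] by linarith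
  qed
  then have "\<bar>cyclic_weight (nb_entry r') p\<bar> \<le> \<theta> ^ length p"
    using edge_potential_pos \<theta>(1) pE(2) by (intro abs_cyclic_weight_le) auto
  moreover have "\<theta> ^ length p < 1" using \<theta> pE(1) by (intro power_less_one_iff[THEN iffD2]) auto
  ultimately show ?thesis by linarith
qed

text \<open>An unconditional sum may be evaluated in stages: over exponents it gives the logarithm
  divided by the length of the primitive word, and over the equally many rotations it removes that
  divisor.\<close>

lemma orbits_has_sum:
  assumes "((\<lambda>es. cyclic_weight (nb_entry r') es / real (length es)) has_sum L)
      {es. es \<noteq> [] \<and> set es \<subseteq> dir_edges R}"
  shows "((\<lambda>\<gamma>. - ln (1 - orbit_weight R \<gamma>)) has_sum L) (backtrackless_orbits R)"
proof -
  let ?O = "backtrackless_orbits R"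
  let ?f = "\<lambda>es. prod_list (map r' es) / real (length es)"
  have "(?f has_sum L) {es. cyclic_path R es \<and> no_backtrack es}"
    using assms
    by (rule has_sum_cong_neutral[THEN iffD1, rotated -1])
      (auto simp: cyclic_weight_nb_entry, auto simp: cyclic_path_def)
  then have s: "((\<lambda>x. ?f ((\<lambda>((\<gamma>, p), m). lpow p m) x)) has_sum L)
      (SIGMA x:(SIGMA \<gamma>:?O. steps ` \<gamma>). {1..})"
    by (simp only: has_sum_reindex_bij_betw[OF bij_betw_orbit_powers, of ?f])
  have facts: "\<gamma> \<in> orbits R" "prod_list (map r' p) = orbit_weight R \<gamma>" "length p > 0"
      "card (steps ` \<gamma>) = length p" "\<And>q. q \<in> steps ` \<gamma> \<Longrightarrow> length q = length p"
    if "\<gamma> \<in> ?O" "p \<in> steps ` \<gamma>" for \<gamma> p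
  proof -
    show o: "\<gamma> \<in> orbits R" using that by (simp add: backtrackless_orbits_def)
    show "prod_list (map r' p) = orbit_weight R \<gamma>" using orbit_weight_eq[OF o that(2)] by simp
    show "length p > 0" using steps_image_orbit(3)[OF o that(2)] by (simp add: primitive_word_def)
    show "card (steps ` \<gamma>) = length p"
      unfolding steps_image_orbit(1)[OF o that(2)]
      by (rule card_rotations_primitive[OF steps_image_orbit(3)[OF o that(2)]])
    show "length q = length p" if "q \<in> steps ` \<gamma>" for q
      using that unfolding steps_image_orbit(1)[OF o \<open>p \<in> steps ` \<gamma>\<close>] by auto
  qed
  have "((\<lambda>(\<gamma>, p). - ln (1 - orbit_weight R \<gamma>) / real (length p)) has_sum L) (SIGMA \<gamma>:?O. steps ` \<gamma>)"
  proof (rule has_sum_Sigma'[OF s])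
    fix x assume "x \<in> (SIGMA \<gamma>:?O. steps ` \<gamma>)"
    then obtain \<gamma> p where x: "x = (\<gamma>, p)" "\<gamma> \<in> ?O" "p \<in> steps ` \<gamma>" by auto
    note fc = facts[OF x(2,3)]
    let ?w = "orbit_weight R \<gamma>"
    have "((\<lambda>m. ?w ^ m / real m * (1 / real (length p))) has_sum (- ln (1 - ?w) * (1 / real (length p)))) {1..}"
      by (intro has_sum_cmult_left neg_ln_has_sum abs_orbit_weight_less_1[OF x(2)])
    moreover have "?f (lpow p m) = ?w ^ m / real m * (1 / real (length p))" for m
    proof -
      have "prod_list (map r' (lpow p m)) = prod_list (map r' p) ^ m"
        by (induction m) auto
      moreover have "length (lpow p m) = m * length p" by (rule length_lpow)
      ultimately show ?thesis using fc(2) by (simp only: of_nat_mult) simp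
    qed
    ultimately show "((\<lambda>m. ?f ((\<lambda>((\<gamma>, p), m). lpow p m) (x, m))) has_sum
        (\<lambda>(\<gamma>, p). - ln (1 - orbit_weight R \<gamma>) / real (length p)) x) {1..}"
      unfolding x(1) prod.case by (simp only: mult_1_right times_divide_eq_right)
  qed
  then show ?thesis
  proof (rule has_sum_Sigma')
    fix \<gamma> assume \<gamma>: "\<gamma> \<in> ?O"
    then have o: "\<gamma> \<in> orbits R" by (simp add: backtrackless_orbits_def)
    define p where "p = orbit_steps \<gamma>"
    have p: "p \<in> steps ` \<gamma>" unfolding p_def by (rule orbit_steps_mem[OF o])
    note fc = facts[OF \<gamma> p]
    have "finite (steps ` \<gamma>)" using fc(3,4) card_ge_0_finite by metis
    moreover have "(\<Sum>q\<in>steps ` \<gamma>. - ln (1 - orbit_weight R \<gamma>) / real (length q)) = - ln (1 - orbit_weight R \<gamma>)"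
    proof -
      have "(\<Sum>q\<in>steps ` \<gamma>. - ln (1 - orbit_weight R \<gamma>) / real (length q))
        = (\<Sum>q\<in>steps ` \<gamma>. - ln (1 - orbit_weight R \<gamma>) / real (length p))"
        using fc(5) by (intro sum.cong) auto
      then show ?thesis using fc(3,4) by simp
    qed
    ultimately show "((\<lambda>q. case (\<gamma>, q) of (\<gamma>, p) \<Rightarrow> - ln (1 - orbit_weight R \<gamma>) / real (length p))
        has_sum - ln (1 - orbit_weight R \<gamma>)) (steps ` \<gamma>)"
      unfolding prod.case using has_sum_finite by metis
  qed
qed

text \<open>The exponential is continuous and turns finite partial sums into finite partial
  products; it inverts each logarithm because every \<open>1 - orbit_weight R \<gamma>\<close> is
  positive.\<close>

lemma orbit_product_tendsto:
  "((\<lambda>F. \<Prod>\<gamma>\<in>F. inverse (1 - orbit_weight R \<gamma>)) \<longlongrightarrow> inverse (Z_bp R * det (1\<^sub>m n - R)))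
     (finite_subsets_at_top (backtrackless_orbits R))"
proof -
  obtain L where L: "exp L = inverse (Z_bp R * det (1\<^sub>m n - R))"
    and s: "((\<lambda>es. cyclic_weight (nb_entry r') es / real (length es)) has_sum L)
      {es. es \<noteq> [] \<and> set es \<subseteq> dir_edges R}"
    by (rule nb_words_has_sum)
  let ?g = "\<lambda>\<gamma>. - ln (1 - orbit_weight R \<gamma>)"
  have "((\<lambda>F. exp (\<Sum>\<gamma>\<in>F. ?g \<gamma>)) \<longlongrightarrow> exp L) (finite_subsets_at_top (backtrackless_orbits R))"
    using orbits_has_sum[OF s] unfolding has_sum_def by (rule tendsto_exp)
  moreover have "exp (\<Sum>\<gamma>\<in>F. ?g \<gamma>) = (\<Prod>\<gamma>\<in>F. inverse (1 - orbit_weight R \<gamma>))"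
    if "finite F" "F \<subseteq> backtrackless_orbits R" for F
  proof -
    have "exp (?g \<gamma>) = inverse (1 - orbit_weight R \<gamma>)" if "\<gamma> \<in> F" for \<gamma>
      using abs_orbit_weight_less_1[of \<gamma>] that \<open>F \<subseteq> _\<close> by (auto simp: exp_minus)
    then show ?thesis by (simp add: exp_sum[OF that(1)])
  qed
  then have "eventually (\<lambda>F. exp (\<Sum>\<gamma>\<in>F. ?g \<gamma>) = (\<Prod>\<gamma>\<in>F. inverse (1 - orbit_weight R \<gamma>)))
      (finite_subsets_at_top (backtrackless_orbits R))"
    by (rule eventually_finite_subsets_at_top_weakI)
  ultimately show ?thesis unfolding L by (rule Lim_transform_eventually)
qed

end

theorem theorem4:
  fixes R :: "real mat" and n :: nat
  assumes "R \<in> carrier_mat n n"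
    and "transpose_mat R = R"
    and "\<forall>i<n. R $$ (i, i) = 0"
    and "spectral_radius (map_mat (\<lambda>x. complex_of_real \<bar>x\<bar>) R) < 1"
  shows "\<exists>P. ((\<lambda>F. \<Prod>\<gamma>\<in>F. inverse (1 - orbit_weight R \<gamma>)) \<longlongrightarrow> P)
              (finite_subsets_at_top (backtrackless_orbits R))
           \<and> inverse (det (1\<^sub>m n - R)) = Z_bp R * P"
proof -
  obtain x where x: "\<And>i. i < n \<Longrightarrow> x i > 0"
    "\<And>i. i < n \<Longrightarrow> (\<Sum>k<n. \<bar>R $$ (i, k)\<bar> * x k) = x i - 1"
    using strictly_superharmonic_exists[OF assms(1,4)] by blast
  have "R $$ (i, j) = R $$ (j, i)" if "i < n" "j < n" for i j
    using assms(1) that arg_cong[OF assms(2), of "\<lambda>A. A $$ (i, j)"] by simp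
  then interpret strictly_superharmonic R n x
    using assms(1,3) x by unfold_locales auto
  \<comment> \<open>The limit is named explicitly; multiplying it by the nonzero
    \<open>Z_bp R\<close> leaves the inverse of \<open>det (I - R)\<close>.\<close>
  show ?thesis
    using orbit_product_tendsto Z_bp_nonzero by (intro exI[of _ "inverse (Z_bp R * det (1\<^sub>m n - R))"]) simp
qed

end
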